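(* Let $T=1$. Let $J(K,\Sigma)=\mathbb E[r_0]$ with $r_0=-(s_1^\top Q_s s_1+a_0^\top Q_a a_0)$, $a_0=Ks_0+\varepsilon_0$, $s_1=As_0+Ba_0$, where $s_0\sim\mathcal N(0,\Sigma_0)$ and $\varepsilon_0\sim\mathcal N(0,\Sigma)$ are independent. Put $F:=A+BK$, $M_{ss}:=F^\top Q_sF+K^\top Q_aK$, $M_{se}:=F^\top Q_sB+K^\top Q_a$, $M_{ee}:=B^\top Q_sB+Q_a$. Let $$\widehat G_K=\Sigma^{-1}\varepsilon_0 s_0^\top\, r_0,\qquad \widehat G_\ell=\big(\Sigma^{-1}(\varepsilon_0\odot\varepsilon_0)-\mathbf 1\big)\,r_0$$ be the REINFORCE estimators. Then: (a) The true gradients of $J$ are $$\nabla_KJ=\mathbb E[\widehat G_K]=-2M_{se}^\top\Sigma_0,\qquad \nabla_\ell J=\mathbb E[\widehat G_\ell]=-2\,\mathrm{diag}(\Sigma M_{ee}).$$ (b) $\mathbb E[\|\widehat G_K\|_{\mathrm F}^2]=E_{1,K}+E_{2,K}+E_{3,K}+E_{4,K}$, where, with $U:=M_{se}M_{se}^\top$ and $V:=M_{se}\Sigma M_{se}^\top$, $$E_{1,K}=\mathrm{IS}_\Sigma(\Sigma^{-2})\,\mathrm{IS}_{\Sigma_0}(I_n,M_{ss},M_{ss}),\qquad E_{2,K}=\mathrm{IS}_{\Sigma_0}(I_n)\,\mathrm{IS}_\Sigma(\Sigma^{-2},M_{ee},M_{ee}),$$ $$E_{3,K}=2\,\mathrm{IS}_{\Sigma_0}(I_n,M_{ss})\,\mathrm{IS}_\Sigma(\Sigma^{-2},M_{ee}),$$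 $$E_{4,K}=4\big(2\,\mathrm{IS}_{\Sigma_0}(I_n,U)+\mathrm{IS}_\Sigma(\Sigma^{-2})\,\mathrm{IS}_{\Sigma_0}(I_n,V)\big).$$ (c) $\mathbb E[\|\widehat G_\ell\|_2^2]=E_{1,\ell}+E_{2,\ell}+E_{3,\ell}+E_{4,\ell}$, where, with $S:=\Sigma^{1/2}M_{ee}\Sigma^{1/2}$, $$E_{1,\ell}=2m\,\mathrm{IS}_{\Sigma_0}(M_{ss},M_{ss}),\qquad E_{2,\ell}=(2m+16)\,\mathrm{tr}(S)^2+(4m+32)\,\mathrm{tr}(S^2)+24\sum_{i=1}^mS_{ii}^2,$$ $$E_{3,\ell}=2\,\mathrm{IS}_{\Sigma_0}(M_{ss})\,(2m+8)\,\mathrm{tr}(S),\qquad E_{4,\ell}=4(2m+8)\,\mathrm{IS}_{\Sigma_0}(M_{se}\Sigma M_{se}^\top).$$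
   Context: Linear system with linear Gaussian policy: $A\in\mathbb R^{n\times n}$, $B\in\mathbb R^{n\times m}$, $K\in\mathbb R^{m\times n}$; $Q_s\in\mathbb R^{n\times n}$ and $Q_a\in\mathbb R^{m\times m}$ are symmetric positive semidefinite; $\Sigma_0\succeq0$ is $n\times n$; the policy covariance is diagonal, $\Sigma=\mathrm{diag}(e^{2\ell_1},\dots,e^{2\ell_m})\succ0$, parameterized by $\ell\in\mathbb R^m$ (the log-standard deviation). $J$ is viewed as a function of $(K,\ell)$; $\nabla_K J$ is the $m\times n$ matrix of partial derivatives and $\nabla_\ell J\in\mathbb R^m$. Notation: $\odot$ is the Hadamard product, $\mathbf 1\in\mathbb R^m$ the all-ones vector, $I_n$ the identity, and $\mathrm{diag}(M)$ of a square matrix $M$ is the vector of its diagonal entries. For $\Omega\succeq0$, $x\sim\mathcal N(0,\Omega)$ and symmetric real matrices $A_1,\dots,A_k$, $\mathrm{IS}_\Omega(A_1,\dots,A_k):=\mathbb E\big[\prod_{i=1}^k x^\top A_ix\big]$. *)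

theory Defs
  imports "HOL-Probability.Probability"
begin

text \<open>
  Conventions: matrices are \<open>real ^ 'n ^ 'm\<close> (\<open>m\<close> rows, \<open>n\<close> columns); the library norm and inner
  product on this type are the Frobenius norm and the Frobenius inner product.  On vectors, \<open>*\<close>
  is the componentwise (Hadamard) product and \<open>1\<close> is the all-ones vector; the identity matrix
  is \<open>mat 1\<close>.
\<close>

definition psd :: "real ^ 'n ^ 'n \<Rightarrow> bool" where
  "psd M \<longleftrightarrow> transpose M = M \<and> (\<forall>x. 0 \<le> x \<bullet> (M *v x))"

definition psd_sqrt :: "real ^ 'n ^ 'n \<Rightarrow> real ^ 'n ^ 'n" where
  "psd_sqrt M = (THE R. psd R \<and> R ** R = M)"

definition diag_of :: "real ^ 'n ^ 'n \<Rightarrow> real ^ 'n" where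
  "diag_of M = (\<chi> i. M $ i $ i)"

definition outer :: "real ^ 'm \<Rightarrow> real ^ 'n \<Rightarrow> real ^ 'n ^ 'm" where
  "outer x y = (\<chi> i j. x $ i * y $ j)"

text \<open>
  The centred Gaussian law with covariance \<open>\<Omega>\<close>, as the law of \<open>\<Omega>\<^sup>1\<^sup>/\<^sup>2 z\<close> with \<open>z\<close> standard normal;
  \<open>\<Omega>\<close> may be singular, so no density is used.
\<close>

definition mvnormal :: "real ^ 'n ^ 'n \<Rightarrow> (real ^ 'n) measure" where
  "mvnormal \<Omega> =
     distr (\<Pi>\<^sub>M i\<in>(UNIV :: 'n set). std_normal_distribution) borel
       (\<lambda>z. psd_sqrt \<Omega> *v (\<chi> i. z i))"

definition IS :: "real ^ 'n ^ 'n \<Rightarrow> (real ^ 'n ^ 'n) list \<Rightarrow> real" where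
  "IS \<Omega> As = (\<integral>x. (\<Prod>M\<leftarrow>As. x \<bullet> (M *v x)) \<partial>mvnormal \<Omega>)"

text \<open>The covariance of the policy with log-standard deviations \<open>l\<close>.\<close>

definition Sigma_of :: "real ^ 'm \<Rightarrow> real ^ 'm ^ 'm" where
  "Sigma_of l = (\<chi> i j. if i = j then exp (2 * l $ i) else 0)"

text \<open>The reward \<open>r\<^sub>0\<close> as a function of the initial state \<open>s\<close> and the policy noise \<open>e\<close>.\<close>

definition reward ::
  "real ^ 'n ^ 'n \<Rightarrow> real ^ 'm ^ 'n \<Rightarrow> real ^ 'n ^ 'n \<Rightarrow> real ^ 'm ^ 'm \<Rightarrow> real ^ 'n ^ 'm \<Rightarrow>
   real ^ 'n \<Rightarrow> real ^ 'm \<Rightarrow> real" where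
  "reward A B Qs Qa K s e =
     (let a = K *v s + e;
          s' = A *v s + B *v a
      in - (s' \<bullet> (Qs *v s') + a \<bullet> (Qa *v a)))"

text \<open>The joint law of the independent pair \<open>(s\<^sub>0, \<epsilon>\<^sub>0)\<close>.\<close>

definition joint :: "real ^ 'n ^ 'n \<Rightarrow> real ^ 'm ^ 'm \<Rightarrow> ((real ^ 'n) \<times> (real ^ 'm)) measure" where
  "joint \<Sigma>0 \<Sigma> = mvnormal \<Sigma>0 \<Otimes>\<^sub>M mvnormal \<Sigma>"

definition J ::
  "real ^ 'n ^ 'n \<Rightarrow> real ^ 'm ^ 'n \<Rightarrow> real ^ 'n ^ 'n \<Rightarrow> real ^ 'm ^ 'm \<Rightarrow> real ^ 'n ^ 'n \<Rightarrow>
   real ^ 'n ^ 'm \<Rightarrow> real ^ 'm ^ 'm \<Rightarrow> real" where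
  "J A B Qs Qa \<Sigma>0 K \<Sigma> = (\<integral>(s, e). reward A B Qs Qa K s e \<partial>joint \<Sigma>0 \<Sigma>)"

text \<open>The REINFORCE estimators, as functions of \<open>s\<^sub>0\<close>, \<open>\<epsilon>\<^sub>0\<close> and the reward \<open>r\<close>.\<close>

definition G_K :: "real ^ 'm ^ 'm \<Rightarrow> real ^ 'n \<Rightarrow> real ^ 'm \<Rightarrow> real \<Rightarrow> real ^ 'n ^ 'm" where
  "G_K \<Sigma> s e r = r *\<^sub>R (matrix_inv \<Sigma> ** outer e s)"

definition G_l :: "real ^ 'm ^ 'm \<Rightarrow> real ^ 'm \<Rightarrow> real \<Rightarrow> real ^ 'm" where
  "G_l \<Sigma> e r = r *\<^sub>R (matrix_inv \<Sigma> *v (e * e) - 1)"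

end

theory Submission
  imports Defs
begin

text \<open>
  Writing \<open>w = M\<^sub>s\<^sub>e\<^sup>T s\<close>, the reward is \<open>- (s \<bullet> M\<^sub>s\<^sub>s s + 2 (w \<bullet> e) + e \<bullet> M\<^sub>e\<^sub>e e)\<close>.  Every integrand is this
  expression or its square, multiplied by a polynomial in \<open>s\<close> and a polynomial in \<open>e\<close>; integrating over
  \<open>e\<close> first, the symmetry \<open>e \<mapsto> - e\<close> removes the odd terms and leaves Gaussian moments of degree at
  most eight.  Substituting \<open>e = \<Sigma>\<^sup>1\<^sup>/\<^sup>2 z\<close>, these are moments of independent standard normal
  variables, which Wick's recursion \<open>E[z\<^sub>i f(z)] = E[\<partial>\<^sub>i f(z)]\<close> evaluates.  The gradients follow by
  differentiating the closed form \<open>- (tr (M\<^sub>s\<^sub>s \<Sigma>\<^sub>0) + tr (M\<^sub>e\<^sub>e \<Sigma>))\<close> of the objective.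
\<close>

section \<open>Square roots of positive semidefinite matrices\<close>

text \<open>\<open>\<Sigma>0\<close> may be singular, so its Gaussian law is available only as an
  image under \<open>psd_sqrt \<Sigma>0\<close>, and \<open>psd_sqrt\<close> is a definite
  description: existence and uniqueness of the root must come from the spectral theorem. For the
  state, the identity root times root equals \<open>\<Sigma>0\<close> then serves only to compute
  second moments, since higher state moments stay inside \<open>IS\<close>. Only the noise, whose
  root is diagonal and explicit, is expanded to degree eight. Each splitting of an integral demands
  integrability; a class of functions closed under sums and products supplies it throughout. In
  whitened coordinates the score for the log-standard deviations has components z_i^2 - 1, the
  second Hermite polynomial. In moments of its square, pairings inside one Hermite factor cancel;
  counting the others gives 2, 8 and 24, and summing over i produces 2m + 8, 2m + 16 and 4m + 32.
  Unbiasedness is a comparison of two separate computations, the means of the estimators and the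
  derivatives of the objective.\<close>

lemma linear_term_vanishes:
  fixes b c :: real
  assumes "\<And>t. 0 \<le> 2 * t * b + t\<^sup>2 * c"
  shows "b = 0"
proof (rule ccontr)
  assume b: "b \<noteq> 0"
  \<comment> \<open>At t = - b / d the quadratic equals (b^2 / d) (c / d - 2), which is negative as
    soon as d > 0 and c < d; the added 1 keeps d positive when c = 0.\<close>
  define d where "d = \<bar>c\<bar> + 1"
  have d: "d > 0" "c < d" by (auto simp: d_def)
  have "2 * (- b / d) * b + (- b / d)\<^sup>2 * c = b\<^sup>2 / d * (c / d - 2)"
    using d by (simp add: field_simps power2_eq_square)
  moreover have "b\<^sup>2 / d * (c / d - 2) < 0"
  proof (rule mult_pos_neg)
    show "0 < b\<^sup>2 / d" using b d by simp
    have "c / d < 1" using d by simp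
    then show "c / d - 2 < 0" by linarith
  qed
  ultimately show False using assms[of "- b / d"] by linarith
qed

text \<open>A maximizer of the Rayleigh quotient over the unit sphere of an invariant subspace is an
  eigenvector, and its orthogonal complement is again invariant.\<close>

lemma selfadjoint_eigenvector:
  fixes f :: "'a::euclidean_space \<Rightarrow> 'a"
  assumes f: "linear f" and sym: "\<And>x y. x \<bullet> f y = f x \<bullet> y"
    and W: "subspace W" "f ` W \<subseteq> W" "W \<noteq> {0}"
  obtains v c where "v \<in> W" "norm v = 1" "f v = c *\<^sub>R v"
proof -
  have cont: "continuous_on A f" for A
    using f by (simp add: linear_continuous_on linear_linear)
  obtain w where w: "w \<in> W" "w \<noteq> 0" using W subspace_0 by blast
  have "w /\<^sub>R norm w \<in> W \<inter> sphere 0 1"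
    using w W(1) by (auto simp: subspace_scale)
  moreover have "compact (W \<inter> sphere 0 1)"
    by (simp add: W(1) closed_Int_compact closed_subspace)
  moreover have "continuous_on (W \<inter> sphere 0 1) (\<lambda>x. x \<bullet> f x)"
    by (intro continuous_intros cont)
  ultimately obtain v where "v \<in> W \<inter> sphere 0 1"
    and "\<And>x. x \<in> W \<inter> sphere 0 1 \<Longrightarrow> x \<bullet> f x \<le> v \<bullet> f v"
    using continuous_attains_sup[of "W \<inter> sphere 0 1" "\<lambda>x. x \<bullet> f x"] by blast
  then have v: "v \<in> W" "norm v = 1"
    and max: "\<And>x. x \<in> W \<Longrightarrow> norm x = 1 \<Longrightarrow> x \<bullet> f x \<le> v \<bullet> f v"
    by auto
  define c where "c = v \<bullet> f v"
  have le: "x \<bullet> f x \<le> c * (x \<bullet> x)" if "x \<in> W" for x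
  proof (cases "x = 0")
    case False
    have "(x /\<^sub>R norm x) \<bullet> f (x /\<^sub>R norm x) \<le> c"
      unfolding c_def using that False W(1) by (intro max) (auto simp: subspace_scale)
    then show ?thesis
      using False by (simp add: linear_cmul[OF f] divide_simps power2_norm_eq_inner[symmetric])
        (simp add: power2_eq_square mult.commute)
  qed (simp add: linear_0[OF f])
  \<comment> \<open>Moving from the maximizer \<open>v\<close> to \<open>v + t w\<close> changes c
    |x|^2 - x \<bullet> f x, which vanishes at \<open>v\<close>, to first order by 2 t |w|^2; the
    symmetry of \<open>f\<close> makes the two cross terms equal. As this expression is nonnegative
    for every t, the residual \<open>w\<close> is zero.\<close>
  define w where "w = c *\<^sub>R v - f v"
  have wW: "w \<in> W" unfolding w_def using W v by (auto intro!: subspace_diff subspace_scale)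
  have "w \<bullet> w = 0"
  proof (rule linear_term_vanishes)
    fix t :: real
    have "v + t *\<^sub>R w \<in> W" using W v wW by (auto intro!: subspace_add subspace_scale)
    from le[OF this] have "0 \<le> c * ((v + t *\<^sub>R w) \<bullet> (v + t *\<^sub>R w))
        - (v + t *\<^sub>R w) \<bullet> f (v + t *\<^sub>R w)" by simp
    also have "\<dots> = (c * (v \<bullet> v) - v \<bullet> f v) + 2 * t * (w \<bullet> w) + t\<^sup>2 * (c * (w \<bullet> w) - w \<bullet> f w)"
    proof -
      have ww: "w \<bullet> f v = c * (v \<bullet> w) - w \<bullet> w"
        by (subst (3) w_def) (simp add: inner_diff_right inner_commute)
      moreover have "v \<bullet> f w = c * (v \<bullet> w) - w \<bullet> w"
        using ww by (simp add: sym[of v w] inner_commute)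
      moreover have "(v + t *\<^sub>R w) \<bullet> f (v + t *\<^sub>R w)
          = v \<bullet> f v + t * (w \<bullet> f v) + t * (v \<bullet> f w) + t\<^sup>2 * (w \<bullet> f w)"
        by (simp add: linear_add[OF f] linear_cmul[OF f] inner_add_left inner_add_right
            power2_eq_square algebra_simps)
      ultimately show ?thesis
        by (simp only: inner_add_left inner_add_right)
          (simp add: inner_commute[of w v] power2_eq_square algebra_simps)
    qed
    also have "c * (v \<bullet> v) - v \<bullet> f v = 0"
      using v by (simp add: c_def dot_square_norm)
    finally show "0 \<le> 2 * t * (w \<bullet> w) + t\<^sup>2 * (c * (w \<bullet> w) - w \<bullet> f w)" by simp
  qed
  then have "f v = c *\<^sub>R v" by (simp add: w_def)
  with v that show ?thesis by blast
qed

text \<open>An arbitrary invariant subspace \<open>W\<close> takes the place of the whole space so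
  that the induction on \<open>dim W\<close> can pass to the complement of an eigenvector inside
  \<open>W\<close>.\<close>

lemma selfadjoint_eigenbasis:
  fixes f :: "'a::euclidean_space \<Rightarrow> 'a"
  assumes f: "linear f" and sym: "\<And>x y. x \<bullet> f y = f x \<bullet> y"
    and W: "subspace W" "f ` W \<subseteq> W"
  shows "\<exists>B. finite B \<and> pairwise orthogonal B \<and> (\<forall>b\<in>B. norm b = 1 \<and> (\<exists>c. f b = c *\<^sub>R b)) \<and> span B = W"
  using W
proof (induction "dim W" arbitrary: W rule: less_induct)
  case less
  show ?case
  proof (cases "W = {0}")
    case True
    then show ?thesis by (intro exI[of _ "{}"]) auto
  next
    case False
    then obtain v c where v: "v \<in> W" "norm v = 1" "f v = c *\<^sub>R v"
      using selfadjoint_eigenvector[OF f sym less.prems] by blast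
    define W' where "W' = {y \<in> W. orthogonal v y}"
    have sub: "subspace W'"
      using less.prems(1) by (auto simp: W'_def subspace_def orthogonal_def inner_add_right)
    have inv: "f ` W' \<subseteq> W'"
      using less.prems(2) v by (auto simp: W'_def orthogonal_def sym)
    have "v \<notin> W'" using v by (auto simp: W'_def orthogonal_def)
    then have "W' \<subset> W" using v by (auto simp: W'_def)
    then have "dim W' < dim W"
      using sub less.prems(1) by (intro dim_psubset) (simp add: span_eq_iff[THEN iffD2])
    from less.hyps[OF this sub inv] obtain B where B: "finite B" "pairwise orthogonal B"
      "\<And>b. b \<in> B \<Longrightarrow> norm b = 1" "\<And>b. b \<in> B \<Longrightarrow> \<exists>c. f b = c *\<^sub>R b" "span B = W'" by blast
    have BW: "B \<subseteq> W'" using B(5) span_superset by blast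
    have "pairwise orthogonal (insert v B)"
      using B(2) BW by (auto simp: pairwise_insert W'_def orthogonal_commute)
    moreover have "span (insert v B) = W"
    proof
      show "span (insert v B) \<subseteq> W"
        using BW v less.prems(1) by (intro span_minimal) (auto simp: W'_def)
      show "W \<subseteq> span (insert v B)"
      proof
        fix w assume w: "w \<in> W"
        have "w - (v \<bullet> w) *\<^sub>R v \<in> W'"
          using w v less.prems(1)
          by (auto simp: W'_def orthogonal_def inner_diff_right dot_square_norm subspace_diff subspace_scale)
        then show "w \<in> span (insert v B)" by (auto simp: span_insert B(5))
      qed
    qed
    ultimately show ?thesis
      using B v by (intro exI[of _ "insert v B"]) auto
  qed
qed

lemma symmetric_matrix_inner:
  fixes M :: "real ^ 'n ^ 'n"
  assumes "transpose M = M"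
  shows "x \<bullet> (M *v y) = (M *v x) \<bullet> y"
  by (metis assms dot_lmul_matrix transpose_matrix_vector)

text \<open>On an eigenvector of \<open>R ** R\<close> with eigenvalue \<open>c\<close> a positive semidefinite \<open>R\<close> must act as
  \<open>sqrt c\<close>, because \<open>R v - sqrt c v\<close> would be an eigenvector of \<open>R\<close> for \<open>- sqrt c\<close>.\<close>

lemma psd_root_on_eigenvector:
  assumes R: "psd R" and v: "(R ** R) *v v = c *\<^sub>R v" and c: "0 \<le> c"
  shows "R *v v = sqrt c *\<^sub>R v"
proof -
  have sR: "transpose R = R" and pR: "\<And>x. 0 \<le> x \<bullet> (R *v x)" using R by (auto simp: psd_def)
  have RR: "R *v (R *v v) = c *\<^sub>R v" using v by (simp add: matrix_vector_mul_assoc)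
  show ?thesis
  proof (cases "c = 0")
    case True
    have "(R *v v) \<bullet> (R *v v) = v \<bullet> (R *v (R *v v))" by (simp add: symmetric_matrix_inner[OF sR])
    with RR True show ?thesis by simp
  next
    case False
    define w where "w = R *v v - sqrt c *\<^sub>R v"
    have "R *v w = - sqrt c *\<^sub>R w"
      using c by (simp add: w_def matrix_vector_mult_diff_distrib RR
          matrix_vector_mult_scaleR algebra_simps)
    with pR[of w] have "sqrt c * (w \<bullet> w) \<le> 0" by simp
    moreover have "sqrt c > 0" using c False by simp
    ultimately have "w \<bullet> w = 0"
      using inner_ge_zero[of w] by (metis less_eq_real_def mult_le_0_iff not_le)
    then show ?thesis by (simp add: w_def)
  qed
qed

lemma psd_eigenbasis:
  fixes M :: "real ^ 'n ^ 'n"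
  assumes M: "psd M"
  obtains B c where "finite B" "pairwise orthogonal B" "\<And>b. b \<in> B \<Longrightarrow> norm b = 1" "span B = UNIV"
    "\<And>b. b \<in> B \<Longrightarrow> M *v b = c b *\<^sub>R b" "\<And>b. b \<in> B \<Longrightarrow> 0 \<le> c b"
proof -
  have sM: "transpose M = M" and pM: "\<And>x. 0 \<le> x \<bullet> (M *v x)" using M by (auto simp: psd_def)
  obtain B where B: "finite B" "pairwise orthogonal B" "\<And>b. b \<in> B \<Longrightarrow> norm b = 1" "span B = UNIV"
    "\<And>b. b \<in> B \<Longrightarrow> \<exists>c. M *v b = c *\<^sub>R b"
    using selfadjoint_eigenbasis[of "(*v) M" UNIV] symmetric_matrix_inner[OF sM] by auto
  then obtain c where c: "\<And>b. b \<in> B \<Longrightarrow> M *v b = c b *\<^sub>R b" by metis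
  have "0 \<le> c b" if "b \<in> B" for b
    using pM[of b] c[OF that] B(3)[OF that] by (simp add: dot_square_norm)
  with B c that show ?thesis by blast
qed

text \<open>The root is given by its spectral formula: scale each vector of an orthonormal
  eigenbasis by the square root of its eigenvalue. Symmetry and positivity are visible in the
  formula, and the square is compared with \<open>M\<close> on the basis only.\<close>

lemma psd_sqrt_exists:
  fixes M :: "real ^ 'n ^ 'n"
  assumes M: "psd M"
  shows "\<exists>R. psd R \<and> R ** R = M"
proof -
  obtain B c where B: "finite B" "pairwise orthogonal B" "\<And>b. b \<in> B \<Longrightarrow> norm b = 1" "span B = UNIV"
    and c: "\<And>b. b \<in> B \<Longrightarrow> M *v b = c b *\<^sub>R b" "\<And>b. b \<in> B \<Longrightarrow> 0 \<le> c b"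
    using psd_eigenbasis[OF M] by blast
  define f where "f x = (\<Sum>b\<in>B. (sqrt (c b) * (b \<bullet> x)) *\<^sub>R b)" for x
  have lf: "linear f"
    by (rule linearI) (simp_all add: f_def inner_add_right algebra_simps sum.distrib scaleR_sum_right)
  define R where "R = matrix f"
  have R: "R *v x = f x" for x using lf by (simp add: R_def matrix_works)
  have fb: "f b = sqrt (c b) *\<^sub>R b" if b: "b \<in> B" for b
  proof -
    have "f b = (\<Sum>a\<in>B. if a = b then sqrt (c b) *\<^sub>R b else 0)"
      unfolding f_def using B b
      by (intro sum.cong) (auto simp: pairwise_def orthogonal_def dot_square_norm)
    then show ?thesis using B b by simp
  qed
  have fsym: "x \<bullet> f y = f x \<bullet> y" for x y
    by (simp add: f_def inner_sum_left inner_sum_right inner_commute mult_ac)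
  have "transpose R = R"
  proof (rule matrix_eq[THEN iffD2], rule allI)
    fix x
    have "(transpose R *v x) \<bullet> y = (R *v x) \<bullet> y" for y
      using fsym[of x y] by (simp add: R[symmetric] dot_lmul_matrix)
    then show "transpose R *v x = R *v x" by (metis vector_eq_rdot)
  qed
  moreover have "0 \<le> x \<bullet> (R *v x)" for x
    unfolding R f_def using c by (auto simp: inner_sum_right inner_commute mult.assoc intro!: sum_nonneg)
  moreover have "R ** R = M"
  proof (rule matrix_eq[THEN iffD2], rule allI)
    fix x
    have "linear (\<lambda>x. (R ** R) *v x)" "linear (\<lambda>x. M *v x)" by simp_all
    then show "(R ** R) *v x = M *v x"
    proof (rule linear_eq_on)
      show "x \<in> span B" using B by simp
      fix b assume "b \<in> B"
      then show "(R ** R) *v b = M *v b"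
        using c by (simp add: matrix_vector_mul_assoc[symmetric] R fb linear_cmul[OF lf])
    qed
  qed
  ultimately show ?thesis by (auto simp: psd_def)
qed

text \<open>On an eigenvector of the common square with eigenvalue c, both roots are forced to act
  as sqrt c. The square is itself positive semidefinite, so such eigenvectors span the
  space.\<close>

lemma psd_sqrt_unique:
  fixes R :: "real ^ 'n ^ 'n"
  assumes R: "psd R" and R': "psd R'" and eq: "R' ** R' = R ** R"
  shows "R' = R"
proof (rule matrix_eq[THEN iffD2], rule allI)
  fix x
  have "transpose (R ** R) = R ** R" using R by (simp add: psd_def matrix_transpose_mul)
  moreover have "x \<bullet> ((R ** R) *v x) = (R *v x) \<bullet> (R *v x)" for x
    using R symmetric_matrix_inner[of R x "R *v x"]
    by (simp add: psd_def matrix_vector_mul_assoc)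
  ultimately have "psd (R ** R)" by (simp add: psd_def)
  then obtain B c where B: "span B = UNIV" and c: "\<And>b. b \<in> B \<Longrightarrow> (R ** R) *v b = c b *\<^sub>R b"
    "\<And>b. b \<in> B \<Longrightarrow> 0 \<le> c b" using psd_eigenbasis by metis
  have "linear (\<lambda>x. R' *v x)" "linear (\<lambda>x. R *v x)" by simp_all
  then show "R' *v x = R *v x"
  proof (rule linear_eq_on)
    show "x \<in> span B" using B by simp
    fix b assume b: "b \<in> B"
    show "R' *v b = R *v b"
      using psd_root_on_eigenvector[OF R c(1)[OF b] c(2)[OF b]]
        psd_root_on_eigenvector[OF R', of b "c b"] eq c[OF b] by simp
  qed
qed

lemma psd_sqrt_eqI:
  assumes "psd R" "R ** R = M"
  shows "psd_sqrt M = R"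
  unfolding psd_sqrt_def using assms psd_sqrt_unique by (intro the_equality) auto

lemma
  assumes "psd M"
  shows psd_psd_sqrt: "psd (psd_sqrt M)" and psd_sqrt_square: "psd_sqrt M ** psd_sqrt M = M"
proof -
  obtain R where "psd R" "R ** R = M" using psd_sqrt_exists[OF assms] by blast
  with psd_sqrt_eqI[of R M] show "psd (psd_sqrt M)" "psd_sqrt M ** psd_sqrt M = M" by auto
qed

section \<open>Diagonal matrices and the policy covariance\<close>

definition diag_mat :: "('n \<Rightarrow> real) \<Rightarrow> real ^ 'n ^ 'n" where
  "diag_mat d = (\<chi> i j. if i = j then d i else 0)"

lemma diag_mat_mult: "diag_mat d ** diag_mat d' = diag_mat (\<lambda>i. d i * d' i)"
  by (simp add: diag_mat_def matrix_matrix_mult_def vec_eq_iff if_distrib[of "\<lambda>x. x * _"] cong: if_cong)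

lemma diag_mat_mult_vec: "(diag_mat d *v x) $ i = d i * x $ i"
  by (simp add: diag_mat_def matrix_vector_mult_def if_distrib[of "\<lambda>x. x * _"] cong: if_cong)

lemma psd_diag_mat: "(\<And>i. 0 \<le> d i) \<Longrightarrow> psd (diag_mat d)"
  unfolding psd_def inner_vec_def diag_mat_mult_vec
  by (auto simp: transpose_def diag_mat_def vec_eq_iff mult.left_commute intro!: sum_nonneg)

lemma Sigma_of_eq: "Sigma_of l = diag_mat (\<lambda>i. exp (2 * l $ i))"
  by (simp add: Sigma_of_def diag_mat_def)

lemma psd_Sigma_of: "psd (Sigma_of l)"
  by (simp add: Sigma_of_eq psd_diag_mat)

lemma psd_sqrt_Sigma_of: "psd_sqrt (Sigma_of l) = diag_mat (\<lambda>i. exp (l $ i))"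
  by (rule psd_sqrt_eqI)
    (simp_all add: psd_diag_mat diag_mat_mult Sigma_of_eq mult_exp_exp)

lemma matrix_inv_Sigma_of: "matrix_inv (Sigma_of l) = diag_mat (\<lambda>i. exp (- 2 * l $ i))"
proof -
  have one: "diag_mat (\<lambda>i. exp (- 2 * l $ i)) ** Sigma_of l = mat 1"
    unfolding Sigma_of_eq diag_mat_mult mult_exp_exp by (simp add: diag_mat_def mat_def)
  then have two: "Sigma_of l ** diag_mat (\<lambda>i. exp (- 2 * l $ i)) = mat 1"
    using matrix_left_right_inverse by blast
  with one have "invertible (Sigma_of l)" unfolding invertible_def by blast
  then have "Sigma_of l ** matrix_inv (Sigma_of l) = mat 1"
    unfolding invertible_def matrix_inv_def by (rule someI2_ex) simp
  with one show ?thesis by (metis matrix_mul_assoc matrix_mul_lid matrix_mul_rid)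
qed

section \<open>Functions with absolute moments of all orders\<close>

text \<open>Integrability alone is not preserved by products. Asking for absolute moments of every
  order yields an algebra of functions, so the integrability of any polynomial in Gaussian
  coordinates follows from its syntax.\<close>

definition all_moments :: "'a measure \<Rightarrow> ('a \<Rightarrow> real) \<Rightarrow> bool" where
  "all_moments M f \<longleftrightarrow> f \<in> borel_measurable M \<and> (\<forall>k. integrable M (\<lambda>x. \<bar>f x\<bar> ^ k))"

lemma all_moments_measurable: "all_moments M f \<Longrightarrow> f \<in> borel_measurable M"
  by (simp add: all_moments_def)

lemma all_moments_integrable:
  assumes "all_moments M f"
  shows "integrable M f"
proof -
  have "integrable M (\<lambda>x. \<bar>f x\<bar> ^ 1)" using assms unfolding all_moments_def by blast
  then show ?thesis using assms by (simp add: all_moments_def integrable_abs_iff)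
qed

lemma (in prob_space) all_moments_const: "all_moments M (\<lambda>_. c)"
  by (simp add: all_moments_def)

lemma all_moments_cmult:
  assumes "all_moments M f"
  shows "all_moments M (\<lambda>x. c * f x)"
  using assms by (auto simp: all_moments_def abs_mult power_mult_distrib)

lemma all_moments_uminus: "all_moments M f \<Longrightarrow> all_moments M (\<lambda>x. - f x)"
  by (auto simp: all_moments_def)

text \<open>By the inequality 2ab \<le> a^2 + b^2, a moment of order k of the product is controlled
  by moments of order 2k of the factors; this doubling is why the class has to contain all orders at
  once.\<close>

lemma all_moments_mult:
  assumes f: "all_moments M f" and g: "all_moments M g"
  shows "all_moments M (\<lambda>x. f x * g x)"
  unfolding all_moments_def
proof safe
  show meas: "(\<lambda>x. f x * g x) \<in> borel_measurable M"
    using f g by (auto simp: all_moments_def)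
  fix k
  have "integrable M (\<lambda>x. \<bar>f x\<bar> ^ (2 * k) + \<bar>g x\<bar> ^ (2 * k))"
    using f g unfolding all_moments_def by (intro Bochner_Integration.integrable_add) blast+
  then show "integrable M (\<lambda>x. \<bar>f x * g x\<bar> ^ k)"
  proof (rule Bochner_Integration.integrable_bound)
    show "(\<lambda>x. \<bar>f x * g x\<bar> ^ k) \<in> borel_measurable M" using meas by measurable
    have "\<bar>f x * g x\<bar> ^ k \<le> \<bar>f x\<bar> ^ (2 * k) + \<bar>g x\<bar> ^ (2 * k)" for x
    proof -
      have "2 * (\<bar>f x\<bar> ^ k * \<bar>g x\<bar> ^ k) \<le> (\<bar>f x\<bar> ^ k)\<^sup>2 + (\<bar>g x\<bar> ^ k)\<^sup>2"
        using sum_squares_bound[of "\<bar>f x\<bar> ^ k" "\<bar>g x\<bar> ^ k"] by (simp add: mult.assoc)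
      moreover have "0 \<le> \<bar>f x\<bar> ^ k * \<bar>g x\<bar> ^ k" by simp
      ultimately have "\<bar>f x\<bar> ^ k * \<bar>g x\<bar> ^ k \<le> (\<bar>f x\<bar> ^ k)\<^sup>2 + (\<bar>g x\<bar> ^ k)\<^sup>2" by linarith
      then show ?thesis
        by (simp add: abs_mult power_mult_distrib power_mult[symmetric] mult.commute)
    qed
    then show "AE x in M. norm (\<bar>f x * g x\<bar> ^ k) \<le> norm (\<bar>f x\<bar> ^ (2 * k) + \<bar>g x\<bar> ^ (2 * k))"
      by (intro AE_I2) simp
  qed
qed

text \<open>The factor \<open>2 ^ k\<close> comes from |f + g| \<le> 2 max |f| |g|; a power of the
  maximum is at most the sum of the powers.\<close>

lemma all_moments_add:
  assumes f: "all_moments M f" and g: "all_moments M g"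
  shows "all_moments M (\<lambda>x. f x + g x)"
  unfolding all_moments_def
proof safe
  show meas: "(\<lambda>x. f x + g x) \<in> borel_measurable M"
    using f g by (auto simp: all_moments_def)
  fix k
  have "integrable M (\<lambda>x. 2 ^ k * (\<bar>f x\<bar> ^ k + \<bar>g x\<bar> ^ k))"
    using f g unfolding all_moments_def
    by (intro integrable_mult_right Bochner_Integration.integrable_add) blast+
  then show "integrable M (\<lambda>x. \<bar>f x + g x\<bar> ^ k)"
  proof (rule Bochner_Integration.integrable_bound)
    show "(\<lambda>x. \<bar>f x + g x\<bar> ^ k) \<in> borel_measurable M" using meas by measurable
    have "\<bar>f x + g x\<bar> ^ k \<le> 2 ^ k * (\<bar>f x\<bar> ^ k + \<bar>g x\<bar> ^ k)" for x
    proof -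
      have "\<bar>f x + g x\<bar> ^ k \<le> (2 * max \<bar>f x\<bar> \<bar>g x\<bar>) ^ k"
        by (rule power_mono) auto
      also have "\<dots> = 2 ^ k * max \<bar>f x\<bar> \<bar>g x\<bar> ^ k" by (simp add: power_mult_distrib)
      also have "\<dots> \<le> 2 ^ k * (\<bar>f x\<bar> ^ k + \<bar>g x\<bar> ^ k)"
        by (rule mult_left_mono) (auto simp: max_def)
      finally show ?thesis .
    qed
    then show "AE x in M. norm (\<bar>f x + g x\<bar> ^ k) \<le> norm (2 ^ k * (\<bar>f x\<bar> ^ k + \<bar>g x\<bar> ^ k))"
      by (intro AE_I2) simp
  qed
qed

lemma all_moments_diff:
  assumes "all_moments M f" "all_moments M g"
  shows "all_moments M (\<lambda>x. f x - g x)"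
  using all_moments_add[OF assms(1) all_moments_uminus[OF assms(2)]] by simp

lemma (in prob_space) all_moments_sum:
  assumes "\<And>i. i \<in> I \<Longrightarrow> all_moments M (f i)"
  shows "all_moments M (\<lambda>x. \<Sum>i\<in>I. f i x)"
  using assms by (induction I rule: infinite_finite_induct)
    (auto intro: all_moments_const all_moments_add)

lemma (in prob_space) all_moments_power:
  "all_moments M f \<Longrightarrow> all_moments M (\<lambda>x. f x ^ k)"
  by (induction k) (auto intro: all_moments_const all_moments_mult)

lemmas (in prob_space) all_moments_intros =
  all_moments_const all_moments_uminus all_moments_mult all_moments_add all_moments_diff
  all_moments_sum all_moments_power

lemma all_moments_distr:
  assumes "g \<in> M \<rightarrow>\<^sub>M N" and "all_moments M (\<lambda>x. f (g x))" and "f \<in> borel_measurable N"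
  shows "all_moments (distr M N g) f"
  using assms by (auto simp: all_moments_def integrable_distr_eq)

lemma all_moments_fst:
  assumes "prob_space M" "prob_space N" and f: "all_moments M f"
  shows "all_moments (M \<Otimes>\<^sub>M N) (\<lambda>x. f (fst x))"
proof -
  interpret M: prob_space M by fact
  interpret N: prob_space N by fact
  interpret pair_prob_space M N ..
  have [measurable]: "f \<in> borel_measurable M" using f by (simp add: all_moments_def)
  have "integrable (distr (M \<Otimes>\<^sub>M N) M fst) (\<lambda>x. \<bar>f x\<bar> ^ k)" for k
    using f unfolding N.distr_pair_fst all_moments_def by blast
  then have "integrable (M \<Otimes>\<^sub>M N) (\<lambda>x. \<bar>f (fst x)\<bar> ^ k)" for k
    by (subst (asm) integrable_distr_eq) auto
  then show ?thesis by (simp add: all_moments_def)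
qed

lemma all_moments_snd:
  assumes M: "prob_space M" and N: "prob_space N" and f: "all_moments N f"
  shows "all_moments (M \<Otimes>\<^sub>M N) (\<lambda>x. f (snd x))"
proof -
  interpret M: prob_space M by fact
  interpret N: prob_space N by fact
  interpret pair_prob_space M N ..
  interpret Q: pair_prob_space N M ..
  have [measurable]: "f \<in> borel_measurable N" using f by (simp add: all_moments_def)
  have "all_moments (N \<Otimes>\<^sub>M M) (\<lambda>x. f (fst x))" using all_moments_fst[OF N M f] .
  then have "integrable (N \<Otimes>\<^sub>M M) (\<lambda>(x, y). \<bar>f x\<bar> ^ k)" for k
    unfolding all_moments_def case_prod_unfold by blast
  then have "integrable (M \<Otimes>\<^sub>M N) (\<lambda>x. \<bar>f (snd x)\<bar> ^ k)" for k
    using Q.integrable_product_swap[of "\<lambda>(x, y). \<bar>f x\<bar> ^ k"]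
    by (simp only: case_prod_unfold fst_conv snd_conv)
  then show ?thesis by (simp add: all_moments_def)
qed

section \<open>Gaussian moments\<close>

text \<open>Gaussian integration by parts in one variable, read off from the explicit moments: odd
  ones vanish, and the even one of order 2r is (2r)! / (2^r r!). For \<open>k = 0\<close> the
  truncated \<open>k - 1\<close> is harmless because the factor \<open>real k\<close> is
  zero.\<close>

lemma std_normal_moment_step:
  "(\<integral>x. x ^ Suc k \<partial>std_normal_distribution) = real k * (\<integral>x. x ^ (k - 1) \<partial>std_normal_distribution)"
proof (cases "even k")
  case True
  then show ?thesis
    using integral_std_normal_distribution_moment_odd[of "Suc k"]
      integral_std_normal_distribution_moment_odd[of "k - 1"] by (cases "k = 0") simp_all
next
  case False
  then obtain r where r: "k = 2 * r + 1" by (rule oddE)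
  have e: "Suc k = 2 * Suc r" "k - 1 = 2 * r" using r by auto
  have "(fact (2 * Suc r) :: real) = (2 * (1 + real r)) * (real k * fact (2 * r))"
    by (simp add: r algebra_simps)
  moreover have "(2 ^ Suc r * fact (Suc r) :: real) = (2 * (1 + real r)) * (2 ^ r * fact r)"
    by simp
  moreover have "2 * (1 + real r) \<noteq> 0" by (simp add: add_nonneg_eq_0_iff)
  ultimately have "(fact (2 * Suc r) / (2 ^ Suc r * fact (Suc r)) :: real) =
      real k * fact (2 * r) / (2 ^ r * fact r)"
    by (metis mult_divide_mult_cancel_left)
  then show ?thesis
    unfolding e std_normal_distribution_even_moments(1)[of "Suc r"]
      std_normal_distribution_even_moments(1)[of r]
    by simp
qed

abbreviation std_gauss :: "('n::finite \<Rightarrow> real) measure" where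
  "std_gauss \<equiv> \<Pi>\<^sub>M i\<in>UNIV. std_normal_distribution"

lemma prob_space_std_normal: "prob_space std_normal_distribution"
  by (rule prob_space_normal_density) simp

interpretation std_gauss: product_prob_space "\<lambda>_::'n::finite. std_normal_distribution" UNIV
  by (simp add: product_prob_space_def product_prob_space_axioms_def product_sigma_finite_def
      prob_space_std_normal prob_space_imp_sigma_finite)

lemma prob_space_std_gauss: "prob_space std_gauss"
  by (rule prob_space_PiM) (rule prob_space_std_normal)

text \<open>A monomial is a word of coordinates with repetitions, so that Wick's recursion can split
  off the first letter and then delete its partner.\<close>

definition monom_fun :: "'n list \<Rightarrow> ('n \<Rightarrow> real) \<Rightarrow> real" where
  "monom_fun js z = (\<Prod>j\<leftarrow>js. z j)"

lemma monom_fun_eq_prod: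
  fixes z :: "'n::finite \<Rightarrow> real"
  shows "monom_fun js z = (\<Prod>j\<in>UNIV. z j ^ count_list js j)"
proof (induction js)
  case (Cons i js)
  have "(\<Prod>j\<in>UNIV. z j ^ count_list (i # js) j) =
      (\<Prod>j\<in>UNIV. (if i = j then z j else 1) * z j ^ count_list js j)"
    by (intro prod.cong) auto
  then show ?case using Cons by (simp add: monom_fun_def prod.distrib)
qed (simp add: monom_fun_def)

lemma all_moments_coord: "all_moments std_gauss (\<lambda>z. z (i :: 'n::finite))"
proof -
  have "integrable std_normal_distribution (\<lambda>x. \<bar>x\<bar> ^ k)" for k
    using integrable_std_normal_distribution_moment[of k, THEN integrable_abs]
    by (simp add: power_abs)
  then have "integrable (distr std_gauss std_normal_distribution (\<lambda>z. z i)) (\<lambda>x. \<bar>x\<bar> ^ k)" for k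
    by (subst distr_PiM_component) (auto intro: prob_space_std_normal)
  then have "integrable std_gauss (\<lambda>z. \<bar>z i\<bar> ^ k)" for k
    by (subst (asm) integrable_distr_eq) auto
  moreover have "(\<lambda>z. z i) \<in> borel_measurable std_gauss"
    using measurable_component_singleton[of i UNIV "\<lambda>_. std_normal_distribution"]
    by (simp add: measurable_def)
  ultimately show ?thesis by (simp add: all_moments_def)
qed

lemma all_moments_monom_fun: "all_moments std_gauss (monom_fun js :: ('n::finite \<Rightarrow> real) \<Rightarrow> real)"
proof -
  show ?thesis
  proof (induction js)
    case Nil
    show ?case using prob_space.all_moments_const[OF prob_space_std_gauss, of 1] by (simp add: monom_fun_def[abs_def])
  next
    case (Cons j js)
    have "monom_fun (j # js) = (\<lambda>z. z j * monom_fun js z)" by (simp add: monom_fun_def fun_eq_iff)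
    with Cons show ?case by (simp add: all_moments_coord all_moments_mult)
  qed
qed

lemma integral_monom_fun:
  "integral\<^sup>L std_gauss (monom_fun js :: ('n::finite \<Rightarrow> real) \<Rightarrow> real) =
    (\<Prod>j\<in>UNIV. \<integral>x. x ^ count_list js j \<partial>std_normal_distribution)"
  unfolding monom_fun_eq_prod[abs_def]
  by (subst std_gauss.product_integral_prod)
    (auto simp: integrable_std_normal_distribution_moment)

text \<open>The derivative in coordinate \<open>i\<close> of the monomial \<open>js\<close> is the
  multiplicity of \<open>i\<close> times the monomial with one \<open>i\<close> deleted, and zero
  when \<open>i\<close> does not occur; this is E[z_i f(z)] = E[\<partial>_i f(z)] for monomials
  f.\<close>

fun wick :: "'n list \<Rightarrow> real" where
  "wick [] = 1"
| "wick (i # js) = (if i \<in> set js then real (count_list js i) * wick (remove1 i js) else 0)"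

lemma count_list_remove1:
  "count_list (remove1 i js) j = (if i = j then count_list js j - 1 else count_list js j)"
  by (induction js) auto

text \<open>By independence the integral is a product over coordinates. Prefixing \<open>i\<close>
  alters only the factor of \<open>i\<close>, to which the one-dimensional recursion
  applies.\<close>

lemma integral_monom_fun_eq_wick:
  "integral\<^sup>L std_gauss (monom_fun js :: ('n::finite \<Rightarrow> real) \<Rightarrow> real) = wick js"
proof (induction js rule: wick.induct)
  case 1
  show ?case using integral_monom_fun[of "[] :: 'n list"] prob_space.prob_space[OF prob_space_std_normal]
    by simp
next
  case (2 i js)
  define m where "m k = (\<integral>x. x ^ k \<partial>std_normal_distribution)" for k
  have step: "m (Suc k) = real k * m (k - 1)" for k unfolding m_def by (rule std_normal_moment_step)
  have I: "integral\<^sup>L std_gauss (monom_fun js' :: ('n \<Rightarrow> real) \<Rightarrow> real) = (\<Prod>j\<in>UNIV. m (count_list js' j))"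
    for js' unfolding m_def by (rule integral_monom_fun)
  have "(\<Prod>j\<in>UNIV. m (count_list (i # js) j)) =
      m (Suc (count_list js i)) * (\<Prod>j\<in>UNIV - {i}. m (count_list js j))"
    by (subst prod.remove[of UNIV i]) (auto intro!: prod.cong)
  also have "\<dots> = real (count_list js i) *
      (m (count_list (remove1 i js) i) * (\<Prod>j\<in>UNIV - {i}. m (count_list (remove1 i js) j)))"
    unfolding step by (simp add: count_list_remove1)
  also have "m (count_list (remove1 i js) i) * (\<Prod>j\<in>UNIV - {i}. m (count_list (remove1 i js) j)) =
      (\<Prod>j\<in>UNIV. m (count_list (remove1 i js) j))"
    by (simp add: prod.remove[of UNIV i])
  finally have "integral\<^sup>L std_gauss (monom_fun (i # js) :: ('n \<Rightarrow> real) \<Rightarrow> real) =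
      real (count_list js i) * integral\<^sup>L std_gauss (monom_fun (remove1 i js) :: ('n \<Rightarrow> real) \<Rightarrow> real)"
    by (simp add: I)
  then show ?case using 2 by auto
qed

text \<open>The density is even and Lebesgue measure is invariant under negation; the product
  measure inherits the symmetry coordinatewise. All vanishing of odd terms rests on this.\<close>

lemma distr_std_gauss_uminus: "distr std_gauss std_gauss (\<lambda>z i. - z i) = (std_gauss :: ('n::finite \<Rightarrow> real) measure)"
proof -
  have std: "distr std_normal_distribution std_normal_distribution uminus = std_normal_distribution"
  proof (rule measure_eqI)
    fix A assume "A \<in> sets (distr std_normal_distribution std_normal_distribution uminus)"
    then have A[measurable]: "A \<in> sets borel" by simp
    have [measurable]: "uminus -` A \<in> sets (borel :: real measure)"
      using measurable_sets[of uminus borel borel A] by simp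
    have "emeasure (distr std_normal_distribution std_normal_distribution uminus) A =
        emeasure std_normal_distribution (uminus -` A)"
      by (subst emeasure_distr) auto
    also have "\<dots> = (\<integral>\<^sup>+x. ennreal (std_normal_density x) * indicator A (- x) \<partial>lborel)"
      by (subst emeasure_density) (auto intro!: nn_integral_cong simp: indicator_def)
    also have "\<dots> = (\<integral>\<^sup>+x. ennreal (std_normal_density (- x)) * indicator A (- x) \<partial>lborel)"
      by (simp add: std_normal_density_def)
    also have "\<dots> = (\<integral>\<^sup>+x. ennreal (std_normal_density x) * indicator A x \<partial>distr lborel borel uminus)"
      by (subst nn_integral_distr) auto
    also have "distr lborel borel uminus = (lborel :: real measure)"
      by (rule lborel_distr_uminus)
    also have "(\<integral>\<^sup>+x. ennreal (std_normal_density x) * indicator A x \<partial>lborel) =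
        emeasure std_normal_distribution A"
      by (subst emeasure_density) auto
    finally show "emeasure (distr std_normal_distribution std_normal_distribution uminus) A =
      emeasure std_normal_distribution A" .
  qed simp
  have eq: "(\<lambda>z i. - z i :: real) = compose (UNIV :: 'n set) uminus"
    by (auto simp: compose_def fun_eq_iff)
  show ?thesis
    unfolding eq
    using distr_PiM_finite_prob_space'[of "UNIV :: 'n set" "\<lambda>_. std_normal_distribution"
        "\<lambda>_. std_normal_distribution" uminus]
    by (simp only: prob_space_std_normal std) simp
qed

section \<open>Gaussian vectors\<close>

lemma measurable_vec_lambda_PiM:
  "(\<lambda>z. \<chi> i. z i) \<in> borel_measurable (std_gauss :: ('n::finite \<Rightarrow> real) measure)"
proof (rule borel_measurable_euclidean_space[THEN iffD2], rule ballI)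
  fix b :: "real ^ 'n" assume "b \<in> Basis"
  then obtain i where b: "b = axis i 1" by (auto simp: Basis_vec_def)
  show "(\<lambda>z. (\<chi> i. z i) \<bullet> b) \<in> borel_measurable (std_gauss :: ('n \<Rightarrow> real) measure)"
    unfolding b inner_axis using all_moments_measurable[OF all_moments_coord[of i]] by simp
qed

lemma measurable_gauss_map:
  "(\<lambda>z. R *v (\<chi> i. z i)) \<in> borel_measurable (std_gauss :: ('n::finite \<Rightarrow> real) measure)"
proof -
  have "(\<lambda>x. R *v x) \<in> borel_measurable borel"
    by (intro borel_measurable_continuous_onI matrix_vector_mult_linear_continuous_on)
  from measurable_compose[OF measurable_vec_lambda_PiM this] show ?thesis .
qed

lemma sets_mvnormal [measurable_cong, simp]: "sets (mvnormal \<Omega>) = sets borel"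
  by (simp add: mvnormal_def)

lemma prob_space_mvnormal: "prob_space (mvnormal \<Omega>)"
  unfolding mvnormal_def
  by (rule prob_space.prob_space_distr[OF prob_space_std_gauss measurable_gauss_map])

lemma integral_mvnormal:
  fixes f :: "real ^ 'n \<Rightarrow> real"
  assumes "all_moments (mvnormal \<Omega>) f"
  shows "integral\<^sup>L (mvnormal \<Omega>) f = (\<integral>z. f (psd_sqrt \<Omega> *v (\<chi> i. z i)) \<partial>std_gauss)"
  using all_moments_measurable[OF assms] unfolding mvnormal_def
  by (subst integral_distr) (auto intro: measurable_gauss_map)

lemma all_moments_vec_nth: "all_moments (mvnormal \<Omega>) (\<lambda>x. x $ i)"
  unfolding mvnormal_def
proof (rule all_moments_distr[OF measurable_gauss_map])
  show "all_moments std_gauss (\<lambda>z. (psd_sqrt \<Omega> *v (\<chi> i. z i)) $ i)"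
    by (simp add: matrix_vector_mult_def prob_space.all_moments_sum[OF prob_space_std_gauss]
        all_moments_cmult all_moments_coord)
qed simp

lemma (in prob_space) all_moments_inner:
  fixes f g :: "'a \<Rightarrow> real ^ 'n"
  assumes "\<And>i. all_moments M (\<lambda>x. f x $ i)" "\<And>i. all_moments M (\<lambda>x. g x $ i)"
  shows "all_moments M (\<lambda>x. f x \<bullet> g x)"
  using assms by (simp add: inner_vec_def all_moments_intros)

lemma (in prob_space) all_moments_mult_vec:
  fixes f :: "'a \<Rightarrow> real ^ 'n"
  assumes "\<And>i. all_moments M (\<lambda>x. f x $ i)"
  shows "all_moments M (\<lambda>x. (R *v f x) $ i)"
  using assms by (simp add: matrix_vector_mult_def all_moments_intros)

text \<open>The linear map given by \<open>psd_sqrt \<Omega>\<close> commutes with negation, so the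
  sign symmetry of the standard Gaussian passes to its image, degenerate or not.\<close>

lemma integral_mvnormal_uminus:
  fixes f :: "real ^ 'n \<Rightarrow> real"
  assumes f: "all_moments (mvnormal \<Omega>) f"
  shows "(\<integral>x. f (- x) \<partial>mvnormal \<Omega>) = integral\<^sup>L (mvnormal \<Omega>) f"
proof -
  let ?R = "psd_sqrt \<Omega>"
  have [measurable]: "f \<in> borel_measurable borel"
    using all_moments_measurable[OF f] by simp
  have [measurable]: "(\<lambda>z. ?R *v (\<chi> i. z i)) \<in> borel_measurable std_gauss"
    by (rule measurable_gauss_map)
  have uminus[measurable]: "(\<lambda>z i. - z i) \<in> std_gauss \<rightarrow>\<^sub>M (std_gauss :: ('n \<Rightarrow> real) measure)"
  proof (rule measurable_PiM_single')
    show "(\<lambda>z. - z i) \<in> std_gauss \<rightarrow>\<^sub>M std_normal_distribution" for i :: 'n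
      using all_moments_measurable[OF all_moments_uminus[OF all_moments_coord[of i]]]
      by (simp cong: measurable_cong_sets)
  qed (simp add: space_PiM)
  have neg: "?R *v (\<chi> i. - z i) = - (?R *v (\<chi> i. z i))" for z :: "'n \<Rightarrow> real"
    by (simp add: vec_eq_iff matrix_vector_mult_def sum_negf)
  have "integral\<^sup>L (mvnormal \<Omega>) f = (\<integral>z. f (?R *v (\<chi> i. z i)) \<partial>distr std_gauss std_gauss (\<lambda>z i. - z i))"
    unfolding distr_std_gauss_uminus by (rule integral_mvnormal[OF f])
  also have "\<dots> = (\<integral>z. f (- (?R *v (\<chi> i. z i))) \<partial>std_gauss)"
    by (subst integral_distr) (auto simp: neg)
  also have "\<dots> = (\<integral>x. f (- x) \<partial>mvnormal \<Omega>)"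
    unfolding mvnormal_def by (subst integral_distr) auto
  finally show ?thesis by simp
qed

lemma integral_odd:
  fixes f :: "real ^ 'n \<Rightarrow> real"
  assumes "all_moments (mvnormal \<Omega>) f" and "\<And>x. f (- x) = - f x"
  shows "integral\<^sup>L (mvnormal \<Omega>) f = 0"
  using integral_mvnormal_uminus[OF assms(1)] assms(2) by simp

lemma integral_eq_wick:
  assumes "\<And>z. f z = monom_fun js z"
  shows "integral\<^sup>L std_gauss (f :: ('n::finite \<Rightarrow> real) \<Rightarrow> real) = wick js"
  using integral_monom_fun_eq_wick[of js] assms by (simp add: ext[of f "monom_fun js"])

lemma integral_std_gauss_2:
  "(\<integral>z. z a * z b \<partial>(std_gauss :: ('n::finite \<Rightarrow> real) measure)) = of_bool (a = b)"
  by (subst integral_eq_wick[of _ "[a, b]"]) (auto simp: monom_fun_def)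

text \<open>With R the root, E[x x^T] = R R^T, and R R^T = R R = \<open>\<Omega>\<close> because the
  root is symmetric.\<close>

lemma second_moment_mvnormal:
  assumes "psd \<Omega>"
  shows "(\<integral>x. x $ i * x $ j \<partial>mvnormal \<Omega>) = \<Omega> $ i $ j"
proof -
  let ?R = "psd_sqrt \<Omega>"
  have sym: "?R $ j $ b = ?R $ b $ j" for b
  proof -
    have "transpose ?R = ?R" using psd_psd_sqrt[OF assms] by (simp add: psd_def)
    moreover have "transpose ?R $ b $ j = ?R $ j $ b" by (simp add: transpose_def)
    ultimately show ?thesis by simp
  qed
  have "(\<integral>x. x $ i * x $ j \<partial>mvnormal \<Omega>) =
      (\<integral>z. (\<Sum>a\<in>UNIV. \<Sum>b\<in>UNIV. ?R $ i $ a * ?R $ j $ b * (z a * z b)) \<partial>std_gauss)"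
    by (subst integral_mvnormal, intro all_moments_mult all_moments_vec_nth)
      (simp add: matrix_vector_mult_def sum_product mult_ac)
  also have "\<dots> = (\<Sum>a\<in>UNIV. \<Sum>b\<in>UNIV. ?R $ i $ a * ?R $ j $ b * of_bool (a = b))"
    by (simp add: Bochner_Integration.integral_sum all_moments_integrable all_moments_mult
        all_moments_coord integral_std_gauss_2)
  also have "\<dots> = (?R ** ?R) $ i $ j"
    by (simp add: of_bool_def matrix_matrix_mult_def if_distrib sym cong: if_cong)
  finally show ?thesis by (simp add: psd_sqrt_square[OF assms])
qed

section \<open>Isserlis expansions and moments weighted by Hermite polynomials\<close>

abbreviation kron :: "'n \<Rightarrow> 'n \<Rightarrow> real" where "kron a b \<equiv> of_bool (a = b)"

lemma integral_std_gauss_sq_2: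
  "(\<integral>z. (z i)\<^sup>2 * (z a * z b) \<partial>(std_gauss :: ('n::finite \<Rightarrow> real) measure)) = kron a b + 2 * kron i a * kron i b"
  by (subst integral_eq_wick[of _ "[i, i, a, b]"]) (auto simp: monom_fun_def power2_eq_square)

text \<open>Isserlis' sum over the partner of \<open>i\<close>, with \<open>xs\<close> collecting
  the letters already passed over. Where \<open>wick\<close> has to decide which indices coincide,
  this form keeps symbolic indices and produces sums of products of \<open>kron\<close>, which can
  then be summed against coefficients.\<close>

fun wick_pair :: "'n \<Rightarrow> 'n list \<Rightarrow> 'n list \<Rightarrow> real" where
  "wick_pair i xs [] = 0"
| "wick_pair i xs (a # ys) = kron i a * wick (xs @ ys) + wick_pair i (xs @ [a]) ys"

text \<open>The recursion processes a word from the left, yet its value is a Gaussian moment, which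
  depends only on the multiplicities of the letters.\<close>

lemma wick_cong_count:
  fixes xs ys :: "'n::finite list"
  assumes "count_list xs = count_list ys"
  shows "wick xs = wick ys"
  using assms by (simp add: integral_monom_fun_eq_wick[symmetric] integral_monom_fun)

lemma wick_pair_eq:
  fixes ys :: "'n::finite list"
  shows "wick_pair i xs ys = real (count_list ys i) * wick (remove1 i (xs @ ys))"
proof (induction ys arbitrary: xs)
  case (Cons a ys)
  \<comment> \<open>If \<open>xs\<close> already contains \<open>i\<close>, \<open>remove1\<close>
    deletes that earlier copy instead of the one just reached; the multiplicities agree, so every
    occurrence of \<open>i\<close> contributes the same value.\<close>
  have "wick (xs @ ys) = wick (remove1 i (xs @ i # ys))"
    by (rule wick_cong_count) (auto simp: fun_eq_iff count_list_remove1)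
  with Cons show ?case by (simp add: algebra_simps)
qed simp

lemma wick_Cons:
  fixes js :: "'n::finite list"
  shows "wick (i # js) = wick_pair i [] js"
  by (simp add: wick_pair_eq)

text \<open>The left side is E[(z_i^2 - 1)^2 z_a z_b]. Subtracting 1 removes pairings inside a
  Hermite factor. If a meets b, the two factors are joined in 2 ways; otherwise a chooses one of 4
  legs and b one of the 2 legs of the other factor, giving 8.\<close>

lemma wick_hermite_6:
  fixes i a b :: "'n::finite"
  shows "wick [i, i, i, i, a, b] - 2 * wick [i, i, a, b] + wick [a, b] = 2 * kron a b + 8 * kron i a * kron i b"
  by (simp add: wick_Cons algebra_simps del: wick.simps(2))

text \<open>The same count with four outer letters: none attached to a Hermite leg (3 pairings,
  weight 2), two attached to different factors (6 choices, weight 8), or all four attached (4! = 24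
  ways).\<close>

lemma wick_hermite_8:
  fixes i a b c d :: "'n::finite"
  shows "wick [i, i, i, i, a, b, c, d] - 2 * wick [i, i, a, b, c, d] + wick [a, b, c, d] =
    2 * (kron a b * kron c d + kron a c * kron b d + kron a d * kron b c) +
    8 * (kron i a * kron i b * kron c d + kron i a * kron i c * kron b d + kron i a * kron i d * kron b c
       + kron i b * kron i c * kron a d + kron i b * kron i d * kron a c + kron i c * kron i d * kron a b) +
    24 * (kron i a * kron i b * kron i c * kron i d)"
  by (simp add: wick_Cons algebra_simps del: wick.simps(2))

lemma integral_hermite_sq:
  fixes js :: "'n::finite list"
  shows "(\<integral>z. ((z i)\<^sup>2 - 1)\<^sup>2 * monom_fun js z \<partial>std_gauss) =
    wick ([i, i, i, i] @ js) - 2 * wick ([i, i] @ js) + wick js"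
proof -
  have "((z i)\<^sup>2 - 1)\<^sup>2 * monom_fun js z =
      monom_fun ([i, i, i, i] @ js) z - 2 * monom_fun ([i, i] @ js) z + monom_fun js z" for z :: "'n \<Rightarrow> real"
    by (simp add: monom_fun_def power2_eq_square algebra_simps)
  then show ?thesis
    by (simp add: integral_monom_fun_eq_wick all_moments_integrable all_moments_monom_fun)
qed

lemma integral_hermite_sq_2:
  "(\<integral>z. ((z i)\<^sup>2 - 1)\<^sup>2 * (z a * z b) \<partial>(std_gauss :: ('n::finite \<Rightarrow> real) measure)) =
    2 * kron a b + 8 * kron i a * kron i b"
  using integral_hermite_sq[of i "[a, b]"] wick_hermite_6[of i a b] by (simp add: monom_fun_def)

lemma integral_hermite_2:
  "(\<integral>z. ((z i)\<^sup>2 - 1) * (z a * z b) \<partial>(std_gauss :: ('n::finite \<Rightarrow> real) measure)) =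
    2 * kron i a * kron i b"
proof -
  have "((z i)\<^sup>2 - 1) * (z a * z b) = (z i)\<^sup>2 * (z a * z b) - z a * z b" for z :: "'n \<Rightarrow> real"
    by (simp add: algebra_simps)
  moreover have "integrable std_gauss (\<lambda>z :: 'n \<Rightarrow> real. (z i)\<^sup>2 * (z a * z b))"
    "integrable std_gauss (\<lambda>z :: 'n \<Rightarrow> real. z a * z b)"
    by (simp_all add: all_moments_integrable all_moments_mult all_moments_coord power2_eq_square)
  ultimately show ?thesis
    by (simp add: integral_std_gauss_sq_2 integral_std_gauss_2 del: of_bool_eq_iff)
qed

lemma integral_sum_coeff:
  assumes "\<And>i. i \<in> I \<Longrightarrow> all_moments M (f i)"
  shows "(\<integral>x. (\<Sum>i\<in>I. c i * f i x) \<partial>M) = (\<Sum>i\<in>I. c i * (\<integral>x. f i x \<partial>M))"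
  using assms by (simp add: all_moments_integrable)

lemma integral_std_gauss_quad:
  fixes T :: "'n::finite \<Rightarrow> 'n \<Rightarrow> real"
  assumes q: "all_moments std_gauss q"
  shows "(\<integral>z. q z * (\<Sum>a\<in>UNIV. \<Sum>b\<in>UNIV. T a b * (z a * z b)) \<partial>std_gauss) =
    (\<Sum>a\<in>UNIV. \<Sum>b\<in>UNIV. T a b * (\<integral>z. q z * (z a * z b) \<partial>std_gauss))"
proof -
  have am: "all_moments std_gauss (\<lambda>z. q z * (z a * z b))" for a b
    using q by (intro all_moments_mult all_moments_coord)
  have "(\<integral>z. q z * (\<Sum>a\<in>UNIV. \<Sum>b\<in>UNIV. T a b * (z a * z b)) \<partial>std_gauss) =
      (\<integral>z. (\<Sum>a\<in>UNIV. \<Sum>b\<in>UNIV. T a b * (q z * (z a * z b))) \<partial>std_gauss)"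
    by (simp add: sum_distrib_left mult.left_commute)
  also have "\<dots> = (\<Sum>a\<in>UNIV. \<Sum>b\<in>UNIV. T a b * (\<integral>z. q z * (z a * z b) \<partial>std_gauss))"
    using am by (simp add: all_moments_integrable)
  finally show ?thesis .
qed

lemma sum_kron:
  fixes f :: "'n::finite \<Rightarrow> real"
  shows "(\<Sum>b\<in>UNIV. f b * kron a b) = f a" "(\<Sum>b\<in>UNIV. f b * kron b a) = f a"
    "(\<Sum>b\<in>UNIV. kron a b * f b) = f a" "(\<Sum>b\<in>UNIV. kron b a * f b) = f a"
  by (simp_all add: of_bool_def if_distrib if_distribR cong: if_cong)

lemma all_moments_hermite_sq: "all_moments std_gauss (\<lambda>z. ((z (i :: 'n::finite))\<^sup>2 - 1)\<^sup>2)"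
  by (intro prob_space.all_moments_intros[OF prob_space_std_gauss] all_moments_coord)

lemma integral_std_gauss_sq_quad:
  fixes T :: "'n::finite \<Rightarrow> 'n \<Rightarrow> real"
  shows "(\<integral>z. (z i)\<^sup>2 * (\<Sum>a\<in>UNIV. \<Sum>b\<in>UNIV. T a b * (z a * z b)) \<partial>std_gauss) =
    (\<Sum>a\<in>UNIV. T a a) + 2 * T i i"
proof -
  have "all_moments std_gauss (\<lambda>z. (z i)\<^sup>2)"
    by (intro prob_space.all_moments_power[OF prob_space_std_gauss] all_moments_coord)
  note quad = integral_std_gauss_quad[OF this]
  have "(\<integral>z. (z i)\<^sup>2 * (\<Sum>a\<in>UNIV. \<Sum>b\<in>UNIV. T a b * (z a * z b)) \<partial>std_gauss) =
    (\<Sum>a\<in>UNIV. \<Sum>b\<in>UNIV. T a b * kron a b) + 2 * (\<Sum>a\<in>UNIV. kron i a * (\<Sum>b\<in>UNIV. T a b * kron i b))"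
    unfolding quad integral_std_gauss_sq_2
    by (simp only: distrib_left sum.distrib sum_distrib_left mult_ac)
  then show ?thesis by (simp only: sum_kron)
qed

lemma integral_std_gauss_hermite_quad:
  fixes T :: "'n::finite \<Rightarrow> 'n \<Rightarrow> real"
  shows "(\<integral>z. ((z i)\<^sup>2 - 1) * (\<Sum>a\<in>UNIV. \<Sum>b\<in>UNIV. T a b * (z a * z b)) \<partial>std_gauss) = 2 * T i i"
proof -
  have "all_moments std_gauss (\<lambda>z. (z i)\<^sup>2 - 1)"
    by (intro prob_space.all_moments_intros[OF prob_space_std_gauss] all_moments_coord)
  note quad = integral_std_gauss_quad[OF this]
  have "(\<integral>z. ((z i)\<^sup>2 - 1) * (\<Sum>a\<in>UNIV. \<Sum>b\<in>UNIV. T a b * (z a * z b)) \<partial>std_gauss) =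
    2 * (\<Sum>a\<in>UNIV. kron i a * (\<Sum>b\<in>UNIV. T a b * kron i b))"
    unfolding quad integral_hermite_2
    by (simp only: sum_distrib_left mult_ac)
  then show ?thesis by (simp only: sum_kron)
qed

lemma integral_std_gauss_hermite_sq_quad:
  fixes T :: "'n::finite \<Rightarrow> 'n \<Rightarrow> real"
  shows "(\<integral>z. ((z i)\<^sup>2 - 1)\<^sup>2 * (\<Sum>a\<in>UNIV. \<Sum>b\<in>UNIV. T a b * (z a * z b)) \<partial>std_gauss) =
    2 * (\<Sum>a\<in>UNIV. T a a) + 8 * T i i"
proof -
  have "(\<integral>z. ((z i)\<^sup>2 - 1)\<^sup>2 * (\<Sum>a\<in>UNIV. \<Sum>b\<in>UNIV. T a b * (z a * z b)) \<partial>std_gauss) =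
    2 * (\<Sum>a\<in>UNIV. \<Sum>b\<in>UNIV. T a b * kron a b) + 8 * (\<Sum>a\<in>UNIV. kron i a * (\<Sum>b\<in>UNIV. T a b * kron i b))"
    unfolding integral_std_gauss_quad[OF all_moments_hermite_sq] integral_hermite_sq_2
    by (simp only: distrib_left sum.distrib sum_distrib_left mult_ac)
  then show ?thesis by (simp only: sum_kron)
qed

lemma integral_std_gauss_hermite_sq:
  "(\<integral>z. ((z i)\<^sup>2 - 1)\<^sup>2 \<partial>(std_gauss :: ('n::finite \<Rightarrow> real) measure)) = 2"
  using integral_hermite_sq[of i "[]"] by (simp add: monom_fun_def)

lemma integral_std_gauss_hermite:
  "(\<integral>z. (z i)\<^sup>2 - 1 \<partial>(std_gauss :: ('n::finite \<Rightarrow> real) measure)) = 0"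
proof -
  have "integrable std_gauss (\<lambda>z :: 'n \<Rightarrow> real. z i * z i)"
    by (simp add: all_moments_integrable all_moments_mult all_moments_coord)
  then show ?thesis
    using integral_std_gauss_2[of i i] prob_space.prob_space[OF prob_space_std_gauss]
    by (simp add: power2_eq_square)
qed

text \<open>Contracting the eighth-order expansion with the coefficients of both quadratic forms: of
  the three terms of weight 2, one gives the squared trace and two the squared Frobenius norm. Of
  the six of weight 8, two give \<open>T i i\<close> times the trace and four the squared norm of
  row i, whence 16 and 32.\<close>

lemma integral_std_gauss_hermite_sq_quad_sq:
  fixes T :: "'n::finite \<Rightarrow> 'n \<Rightarrow> real"
  assumes sym: "\<And>a b. T a b = T b a"
  shows "(\<integral>z. ((z i)\<^sup>2 - 1)\<^sup>2 * (\<Sum>a\<in>UNIV. \<Sum>b\<in>UNIV. T a b * (z a * z b))\<^sup>2 \<partial>std_gauss) =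
    2 * (\<Sum>a\<in>UNIV. T a a)\<^sup>2 + 4 * (\<Sum>a\<in>UNIV. \<Sum>b\<in>UNIV. (T a b)\<^sup>2) +
    16 * T i i * (\<Sum>a\<in>UNIV. T a a) + 32 * (\<Sum>a\<in>UNIV. (T i a)\<^sup>2) + 24 * (T i i)\<^sup>2"
proof -
  let ?Q = "\<lambda>z. \<Sum>a\<in>UNIV. \<Sum>b\<in>UNIV. T a b * (z a * z b)"
  have am: "all_moments std_gauss (\<lambda>z. ((z i)\<^sup>2 - 1)\<^sup>2 * ?Q z)"
    by (intro prob_space.all_moments_intros[OF prob_space_std_gauss] all_moments_coord)
  have am2: "all_moments std_gauss (\<lambda>z. ((z i)\<^sup>2 - 1)\<^sup>2 * (z a * z b))" for a b
    by (intro prob_space.all_moments_intros[OF prob_space_std_gauss] all_moments_coord)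
  have H: "(\<integral>z. ((z i)\<^sup>2 - 1)\<^sup>2 * (z a * z b) * (z c * z d) \<partial>std_gauss) =
    2 * (kron a b * kron c d + kron a c * kron b d + kron a d * kron b c) +
    8 * (kron i a * kron i b * kron c d + kron i a * kron i c * kron b d + kron i a * kron i d * kron b c
       + kron i b * kron i c * kron a d + kron i b * kron i d * kron a c + kron i c * kron i d * kron a b) +
    24 * (kron i a * kron i b * kron i c * kron i d)" for a b c d
    using integral_hermite_sq[of i "[a, b, c, d]"] wick_hermite_8[of i a b c d]
    by (simp add: monom_fun_def mult.assoc)
  \<comment> \<open>One factor of the squared form is integrated first, with the indices a and b of
    the other still free; each sum then collapses at a \<open>kron\<close>.\<close>
  have inner: "(\<integral>z. ((z i)\<^sup>2 - 1)\<^sup>2 * (z a * z b) * ?Q z \<partial>std_gauss) =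
    2 * kron a b * (\<Sum>c\<in>UNIV. T c c) + 4 * T a b + 8 * kron i a * kron i b * (\<Sum>c\<in>UNIV. T c c)
    + 16 * kron i a * T i b + 16 * kron i b * T i a + 8 * kron a b * T i i + 24 * kron i a * kron i b * T i i"
    for a b
  proof -
    have "(\<integral>z. ((z i)\<^sup>2 - 1)\<^sup>2 * (z a * z b) * ?Q z \<partial>std_gauss) =
      2 * kron a b * (\<Sum>c\<in>UNIV. \<Sum>d\<in>UNIV. T c d * kron c d)
      + 2 * (\<Sum>c\<in>UNIV. kron a c * (\<Sum>d\<in>UNIV. T c d * kron b d))
      + 2 * (\<Sum>c\<in>UNIV. kron b c * (\<Sum>d\<in>UNIV. T c d * kron a d))
      + 8 * kron i a * kron i b * (\<Sum>c\<in>UNIV. \<Sum>d\<in>UNIV. T c d * kron c d)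
      + 8 * kron i a * (\<Sum>c\<in>UNIV. kron i c * (\<Sum>d\<in>UNIV. T c d * kron b d))
      + 8 * kron i a * (\<Sum>c\<in>UNIV. kron b c * (\<Sum>d\<in>UNIV. T c d * kron i d))
      + 8 * kron i b * (\<Sum>c\<in>UNIV. kron i c * (\<Sum>d\<in>UNIV. T c d * kron a d))
      + 8 * kron i b * (\<Sum>c\<in>UNIV. kron a c * (\<Sum>d\<in>UNIV. T c d * kron i d))
      + 8 * kron a b * (\<Sum>c\<in>UNIV. kron i c * (\<Sum>d\<in>UNIV. T c d * kron i d))
      + 24 * kron i a * kron i b * (\<Sum>c\<in>UNIV. kron i c * (\<Sum>d\<in>UNIV. T c d * kron i d))"
      unfolding integral_std_gauss_quad[OF am2] H
      by (simp only: distrib_left sum.distrib sum_distrib_left mult_ac add_ac)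
    then show ?thesis by (simp only: sum_kron) (simp add: sym[of b a] sym[of a i] sym[of b i] algebra_simps)
  qed
  have "(\<integral>z. ((z i)\<^sup>2 - 1)\<^sup>2 * (?Q z)\<^sup>2 \<partial>std_gauss) =
      (\<integral>z. (((z i)\<^sup>2 - 1)\<^sup>2 * ?Q z) * ?Q z \<partial>std_gauss)"
    by (simp only: power2_eq_square mult.assoc)
  also have "\<dots> = (\<Sum>a\<in>UNIV. \<Sum>b\<in>UNIV. T a b * (\<integral>z. ((z i)\<^sup>2 - 1)\<^sup>2 * (z a * z b) * ?Q z \<partial>std_gauss))"
    unfolding integral_std_gauss_quad[OF am] by (simp only: mult.assoc mult.left_commute mult.commute)
  also have "\<dots> = 2 * (\<Sum>c\<in>UNIV. T c c) * (\<Sum>a\<in>UNIV. \<Sum>b\<in>UNIV. T a b * kron a b)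
      + 4 * (\<Sum>a\<in>UNIV. \<Sum>b\<in>UNIV. T a b * T a b)
      + 8 * (\<Sum>c\<in>UNIV. T c c) * (\<Sum>a\<in>UNIV. kron i a * (\<Sum>b\<in>UNIV. T a b * kron i b))
      + 16 * (\<Sum>a\<in>UNIV. kron i a * (\<Sum>b\<in>UNIV. T a b * T i b))
      + 16 * (\<Sum>a\<in>UNIV. T i a * (\<Sum>b\<in>UNIV. T a b * kron i b))
      + 8 * T i i * (\<Sum>a\<in>UNIV. \<Sum>b\<in>UNIV. T a b * kron a b)
      + 24 * T i i * (\<Sum>a\<in>UNIV. kron i a * (\<Sum>b\<in>UNIV. T a b * kron i b))"
    unfolding inner
    by (simp only: distrib_left sum.distrib) (simp only: sum_distrib_left mult_ac)
  also have "(\<Sum>a\<in>UNIV. T i a * (\<Sum>b\<in>UNIV. T a b * kron i b)) = (\<Sum>a\<in>UNIV. T i a * T i a)"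
    unfolding sum_kron by (intro sum.cong refl arg_cong2[where f = "(*)"] sym)
  finally show ?thesis
    by (simp only: sum_kron) (simp add: power2_eq_square algebra_simps)
qed

section \<open>The reward and its square as functions of a Gaussian vector\<close>

lemma all_moments_quad:
  "all_moments (mvnormal \<Omega>) (\<lambda>x. x \<bullet> (M *v x))"
  by (intro prob_space.all_moments_inner[OF prob_space_mvnormal]
      prob_space.all_moments_mult_vec[OF prob_space_mvnormal] all_moments_vec_nth)

lemma all_moments_inner_const:
  "all_moments (mvnormal \<Omega>) (\<lambda>x. w \<bullet> x)"
  by (intro prob_space.all_moments_inner[OF prob_space_mvnormal]
      prob_space.all_moments_const[OF prob_space_mvnormal] all_moments_vec_nth)

lemmas all_moments_mvnormal_intros =
  all_moments_quad all_moments_inner_const all_moments_vec_nth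
  prob_space.all_moments_intros[OF prob_space_mvnormal]
  prob_space.all_moments_mult_vec[OF prob_space_mvnormal]
  prob_space.all_moments_inner[OF prob_space_mvnormal]

lemma quad_eq_sum: "x \<bullet> (M *v x) = (\<Sum>a\<in>UNIV. \<Sum>b\<in>UNIV. M $ a $ b * (x $ a * x $ b))"
  by (simp add: inner_vec_def matrix_vector_mult_def sum_distrib_left mult_ac)

text \<open>The trace of M^T \<open>\<Omega>\<close> is kept as a Frobenius product, the form to
  which the derivative rule for inner products applies later.\<close>

lemma integral_quad:
  assumes "psd \<Omega>"
  shows "(\<integral>x. x \<bullet> (M *v x) \<partial>mvnormal \<Omega>) = M \<bullet> \<Omega>"
  unfolding quad_eq_sum unfolding inner_vec_def inner_real_def
  by (simp add: all_moments_integrable all_moments_mult all_moments_vec_nth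
      second_moment_mvnormal[OF assms])

lemma integral_nth_inner:
  assumes "psd \<Omega>"
  shows "(\<integral>x. x $ i * (w \<bullet> x) \<partial>mvnormal \<Omega>) = (\<Omega> *v w) $ i"
proof -
  have "(\<integral>x. x $ i * (w \<bullet> x) \<partial>mvnormal \<Omega>) = (\<integral>x. (\<Sum>j\<in>UNIV. w $ j * (x $ i * x $ j)) \<partial>mvnormal \<Omega>)"
    by (simp add: inner_vec_def sum_distrib_left mult_ac)
  also have "\<dots> = (\<Sum>j\<in>UNIV. w $ j * \<Omega> $ i $ j)"
    by (simp add: all_moments_integrable all_moments_mult all_moments_vec_nth
        second_moment_mvnormal[OF assms])
  finally show ?thesis by (simp add: matrix_vector_mult_def mult.commute)
qed

lemma matrix_vector_mult_uminus: "M *v (- x) = - (M *v (x :: real ^ 'n))"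
  by (simp add: vec_eq_iff matrix_vector_mult_def sum_negf)

text \<open>This is the inner integral over the noise with the state frozen: \<open>a\<close> and
  \<open>w\<close> stand for the parts of the reward that depend on the state.\<close>

lemma integral_even_mult_reward:
  assumes q: "all_moments (mvnormal \<Omega>) q" and even: "\<And>x. q (- x) = q x"
  shows "(\<integral>x. q x * (a + 2 * (w \<bullet> x) + x \<bullet> (M *v x)) \<partial>mvnormal \<Omega>) =
    a * (\<integral>x. q x \<partial>mvnormal \<Omega>) + (\<integral>x. q x * (x \<bullet> (M *v x)) \<partial>mvnormal \<Omega>)"
proof -
  note am = q all_moments_mvnormal_intros
  have odd: "(\<integral>x. q x * (w \<bullet> x) \<partial>mvnormal \<Omega>) = 0"
    by (rule integral_odd, intro am) (simp add: even inner_minus_right)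
  have 1: "all_moments (mvnormal \<Omega>) (\<lambda>x. q x * (w \<bullet> x))"
    "all_moments (mvnormal \<Omega>) (\<lambda>x. q x * (x \<bullet> (M *v x)))"
    by (intro am)+
  have "(\<integral>x. q x * (a + 2 * (w \<bullet> x) + x \<bullet> (M *v x)) \<partial>mvnormal \<Omega>) =
    (\<integral>x. a * q x + 2 * (q x * (w \<bullet> x)) + q x * (x \<bullet> (M *v x)) \<partial>mvnormal \<Omega>)"
    by (simp only: distrib_left mult_ac)
  also have "\<dots> = a * (\<integral>x. q x \<partial>mvnormal \<Omega>) + 2 * (\<integral>x. q x * (w \<bullet> x) \<partial>mvnormal \<Omega>)
      + (\<integral>x. q x * (x \<bullet> (M *v x)) \<partial>mvnormal \<Omega>)"
    using q 1 by (simp add: all_moments_integrable)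
  finally show ?thesis by (simp add: odd)
qed

text \<open>Squaring the three-term reward gives six products. The two that contain
  \<open>w \<bullet> x\<close> to first order are odd and vanish; the remaining four are, in this
  order, the origins of the terms E1 to E4 of both second moments.\<close>

lemma integral_even_mult_reward_sq:
  assumes q: "all_moments (mvnormal \<Omega>) q" and even: "\<And>x. q (- x) = q x"
  shows "(\<integral>x. q x * (a + 2 * (w \<bullet> x) + x \<bullet> (M *v x))\<^sup>2 \<partial>mvnormal \<Omega>) =
    a\<^sup>2 * (\<integral>x. q x \<partial>mvnormal \<Omega>) + (\<integral>x. q x * (x \<bullet> (M *v x))\<^sup>2 \<partial>mvnormal \<Omega>)
    + 2 * a * (\<integral>x. q x * (x \<bullet> (M *v x)) \<partial>mvnormal \<Omega>) + 4 * (\<integral>x. q x * (w \<bullet> x)\<^sup>2 \<partial>mvnormal \<Omega>)"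
proof -
  note am = q all_moments_mvnormal_intros
  have odd: "(\<integral>x. q x * (w \<bullet> x) \<partial>mvnormal \<Omega>) = 0"
    "(\<integral>x. q x * (w \<bullet> x) * (x \<bullet> (M *v x)) \<partial>mvnormal \<Omega>) = 0"
    by (rule integral_odd, intro am, simp add: even inner_minus_right matrix_vector_mult_uminus)+
  have 1: "all_moments (mvnormal \<Omega>) (\<lambda>x. q x * (w \<bullet> x))"
    "all_moments (mvnormal \<Omega>) (\<lambda>x. q x * (w \<bullet> x) * (x \<bullet> (M *v x)))"
    "all_moments (mvnormal \<Omega>) (\<lambda>x. q x * (x \<bullet> (M *v x)))"
    "all_moments (mvnormal \<Omega>) (\<lambda>x. q x * (x \<bullet> (M *v x))\<^sup>2)"
    "all_moments (mvnormal \<Omega>) (\<lambda>x. q x * (w \<bullet> x)\<^sup>2)"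
    by (intro am)+
  have eq: "q x * (a + 2 * (w \<bullet> x) + x \<bullet> (M *v x))\<^sup>2 =
      a\<^sup>2 * q x + q x * (x \<bullet> (M *v x))\<^sup>2 + (2 * a) * (q x * (x \<bullet> (M *v x)))
      + 4 * (q x * (w \<bullet> x)\<^sup>2) + (4 * a) * (q x * (w \<bullet> x)) + 4 * (q x * (w \<bullet> x) * (x \<bullet> (M *v x)))" for x
    by (simp add: power2_eq_square algebra_simps)
  show ?thesis
    unfolding eq using q 1 by (simp add: all_moments_integrable odd)
qed

text \<open>Here the multiplier is itself odd, so parity selects the opposite part: only the cross
  term of state and noise survives.\<close>

lemma integral_nth_mult_reward:
  assumes "psd \<Omega>"
  shows "(\<integral>x. x $ i * (a + 2 * (w \<bullet> x) + x \<bullet> (M *v x)) \<partial>mvnormal \<Omega>) = 2 * (\<Omega> *v w) $ i"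
proof -
  note am = all_moments_mvnormal_intros
  have odd: "(\<integral>x. x $ i \<partial>mvnormal \<Omega>) = 0" "(\<integral>x. x $ i * (x \<bullet> (M *v x)) \<partial>mvnormal \<Omega>) = 0"
    by (rule integral_odd, intro am, simp add: matrix_vector_mult_uminus)+
  have 1: "all_moments (mvnormal \<Omega>) (\<lambda>x. x $ i)"
    "all_moments (mvnormal \<Omega>) (\<lambda>x. x $ i * (w \<bullet> x))"
    "all_moments (mvnormal \<Omega>) (\<lambda>x. x $ i * (x \<bullet> (M *v x)))"
    by (intro am)+
  have "(\<integral>x. x $ i * (a + 2 * (w \<bullet> x) + x \<bullet> (M *v x)) \<partial>mvnormal \<Omega>) =
    (\<integral>x. a * x $ i + 2 * (x $ i * (w \<bullet> x)) + x $ i * (x \<bullet> (M *v x)) \<partial>mvnormal \<Omega>)"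
    by (simp only: distrib_left mult_ac)
  also have "\<dots> = a * (\<integral>x. x $ i \<partial>mvnormal \<Omega>) + 2 * (\<integral>x. x $ i * (w \<bullet> x) \<partial>mvnormal \<Omega>)
      + (\<integral>x. x $ i * (x \<bullet> (M *v x)) \<partial>mvnormal \<Omega>)"
    using 1 by (simp add: all_moments_integrable)
  finally show ?thesis by (simp add: odd integral_nth_inner[OF assms])
qed

section \<open>The policy noise\<close>

lemma integral_mvnormal_Sigma_of:
  fixes f :: "real ^ 'm \<Rightarrow> real"
  assumes "all_moments (mvnormal (Sigma_of l)) f"
  shows "integral\<^sup>L (mvnormal (Sigma_of l)) f = (\<integral>z. f (\<chi> i. exp (l $ i) * z i) \<partial>std_gauss)"
proof -
  have "diag_mat (\<lambda>i. exp (l $ i)) *v (\<chi> i. z i) = (\<chi> i. exp (l $ i) * z i)" for z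
    by (simp add: vec_eq_iff diag_mat_mult_vec)
  then show ?thesis using integral_mvnormal[OF assms] by (simp add: psd_sqrt_Sigma_of)
qed

text \<open>The matrix of the quadratic form in whitened noise coordinates; for \<open>Mee\<close>
  it is the matrix \<open>S\<close> of the theorem.\<close>

definition sandwich :: "real ^ 'm \<Rightarrow> real ^ 'm ^ 'm \<Rightarrow> real ^ 'm ^ 'm" where
  "sandwich l M = psd_sqrt (Sigma_of l) ** M ** psd_sqrt (Sigma_of l)"

lemma sandwich_nth: "sandwich l M $ a $ b = exp (l $ a) * M $ a $ b * exp (l $ b)"
  by (simp add: sandwich_def psd_sqrt_Sigma_of diag_mat_def matrix_matrix_mult_def
      if_distrib if_distribR cong: if_cong)

lemma quad_scaled:
  fixes l :: "real ^ 'm"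
  shows "(\<chi> i. exp (l $ i) * z i) \<bullet> (M *v (\<chi> i. exp (l $ i) * z i)) =
    (\<Sum>a\<in>UNIV. \<Sum>b\<in>UNIV. sandwich l M $ a $ b * (z a * z b))"
  by (simp add: quad_eq_sum sandwich_nth mult_ac)

lemma inner_scaled_sq:
  fixes l :: "real ^ 'm"
  shows "(w \<bullet> (\<chi> i. exp (l $ i) * z i))\<^sup>2 =
    (\<Sum>a\<in>UNIV. \<Sum>b\<in>UNIV. (w $ a * exp (l $ a) * (w $ b * exp (l $ b))) * (z a * z b))"
  by (simp add: inner_vec_def power2_eq_square sum_product mult_ac)

lemma Sigma_of_quad: "w \<bullet> (Sigma_of l *v w) = (\<Sum>a\<in>UNIV. w $ a * exp (l $ a) * (w $ a * exp (l $ a)))"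
proof -
  have "exp (2 * l $ a) = exp (l $ a) * exp (l $ a)" for a by (simp add: mult_exp_exp)
  then show ?thesis by (simp only: inner_vec_def Sigma_of_eq diag_mat_mult_vec inner_real_def mult_ac)
qed

abbreviation precision_sq :: "real ^ 'm \<Rightarrow> real ^ 'm ^ 'm" where
  "precision_sq l \<equiv> matrix_inv (Sigma_of l) ** matrix_inv (Sigma_of l)"

lemma precision_sq_eq: "precision_sq l = diag_mat (\<lambda>i. (exp (- 2 * l $ i))\<^sup>2)"
  by (simp add: matrix_inv_Sigma_of diag_mat_mult power2_eq_square)

lemma precision_sq_quad:
  "e \<bullet> (precision_sq l *v e) = (\<Sum>i\<in>UNIV. (exp (- 2 * l $ i) * e $ i)\<^sup>2)"
  unfolding precision_sq_eq inner_vec_def diag_mat_mult_vec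
  by (simp add: power2_eq_square mult_ac)

lemma precision_sq_scaled:
  fixes l :: "real ^ 'm"
  shows "(\<chi> i. exp (l $ i) * z i) \<bullet> (precision_sq l *v (\<chi> i. exp (l $ i) * z i)) =
    (\<Sum>i\<in>UNIV. exp (- 2 * l $ i) * (z i)\<^sup>2)"
  unfolding precision_sq_quad
proof (rule sum.cong[OF refl])
  fix i
  have "exp (- 2 * l $ i) * exp (- 2 * l $ i) * (exp (l $ i) * exp (l $ i)) = exp (- 2 * l $ i)"
    by (simp add: mult_exp_exp)
  then show "(exp (- 2 * l $ i) * (\<chi> i. exp (l $ i) * z i) $ i)\<^sup>2 = exp (- 2 * l $ i) * (z i)\<^sup>2"
    unfolding power2_eq_square by (simp add: mult_ac)
qed

lemma integral_precision_sq:
  "(\<integral>e. e \<bullet> (precision_sq l *v e) \<partial>mvnormal (Sigma_of l)) = (\<Sum>i\<in>UNIV. exp (- 2 * l $ i))"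
  by (simp add: integral_std_gauss_2 integral_mvnormal_Sigma_of all_moments_quad precision_sq_scaled power2_eq_square
      all_moments_integrable all_moments_mult all_moments_coord)

text \<open>The weight exp (- 2 l_i) left over from the squared precision cancels the variance in
  (w_i exp l_i)^2, so the term in which the two factors are paired with each other becomes 2 |w|^2,
  free of the covariance. It is the source of the summand with \<open>U\<close> in
  \<open>E4K\<close>; the disconnected pairing yields the one with \<open>V\<close>.\<close>

lemma integral_precision_sq_inner:
  fixes l w :: "real ^ 'm"
  shows "(\<integral>e. e \<bullet> (precision_sq l *v e) * (w \<bullet> e)\<^sup>2 \<partial>mvnormal (Sigma_of l)) =
    (\<Sum>i\<in>UNIV. exp (- 2 * l $ i)) * (w \<bullet> (Sigma_of l *v w)) + 2 * (w \<bullet> w)"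
proof -
  let ?T = "\<lambda>a b. w $ a * exp (l $ a) * (w $ b * exp (l $ b))"
  let ?Q = "\<lambda>z. \<Sum>a\<in>UNIV. \<Sum>b\<in>UNIV. ?T a b * (z a * z b)"
  have am: "all_moments std_gauss (\<lambda>z. (z i)\<^sup>2 * ?Q z)" for i
    by (intro prob_space.all_moments_intros[OF prob_space_std_gauss] all_moments_coord)
  have "(\<integral>e. e \<bullet> (precision_sq l *v e) * (w \<bullet> e)\<^sup>2 \<partial>mvnormal (Sigma_of l)) =
      (\<integral>z. (\<Sum>i\<in>UNIV. exp (- 2 * l $ i) * (z i)\<^sup>2) * ?Q z \<partial>std_gauss)"
    by (subst integral_mvnormal_Sigma_of, intro all_moments_mvnormal_intros)
      (simp only: precision_sq_scaled inner_scaled_sq)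
  also have "\<dots> = (\<integral>z. (\<Sum>i\<in>UNIV. exp (- 2 * l $ i) * ((z i)\<^sup>2 * ?Q z)) \<partial>std_gauss)"
    by (simp only: sum_distrib_right mult.assoc)
  also have "\<dots> = (\<Sum>i\<in>UNIV. exp (- 2 * l $ i) * ((\<Sum>a\<in>UNIV. ?T a a) + 2 * ?T i i))"
    by (subst integral_sum_coeff, rule am) (simp only: integral_std_gauss_sq_quad)
  also have "\<dots> = (\<Sum>i\<in>UNIV. exp (- 2 * l $ i)) * (\<Sum>a\<in>UNIV. ?T a a) + 2 * (w \<bullet> w)"
  proof -
    have "exp (- 2 * l $ i) * ?T i i = w $ i * w $ i" for i
    proof -
      have "exp (- 2 * l $ i) * (exp (l $ i) * exp (l $ i)) = 1" by (simp add: mult_exp_exp)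
      then show ?thesis by (simp add: mult_ac)
    qed
    moreover have "(\<Sum>i\<in>UNIV. c i * (A + 2 * t i)) = (\<Sum>i\<in>UNIV. c i) * A + 2 * (\<Sum>i\<in>UNIV. c i * t i)"
      for c t :: "'m \<Rightarrow> real" and A
      by (simp add: distrib_left sum.distrib sum_distrib_right sum_distrib_left mult.left_commute)
    ultimately show ?thesis by (simp only: inner_vec_def inner_real_def)
  qed
  finally show ?thesis by (simp only: Sigma_of_quad)
qed

text \<open>The gradient of the Gaussian log-density of the noise in the log-standard
  deviations.\<close>

definition score :: "real ^ 'm \<Rightarrow> real ^ 'm \<Rightarrow> real ^ 'm" where
  "score l e = matrix_inv (Sigma_of l) *v (e * e) - 1"

lemma score_scaled:
  fixes l :: "real ^ 'm"
  shows "score l (\<chi> i. exp (l $ i) * z i) $ i = (z i)\<^sup>2 - 1"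
proof -
  have "exp (- 2 * l $ i) * (exp (l $ i) * exp (l $ i)) = 1" by (simp add: mult_exp_exp)
  then show ?thesis
    unfolding score_def matrix_inv_Sigma_of power2_eq_square vector_minus_component diag_mat_mult_vec
    by (simp add: mult_ac)
qed

lemma score_uminus: "score l (- e) = score l e"
  by (simp add: score_def)

lemma all_moments_score: "all_moments (mvnormal \<Omega>) (\<lambda>e. score l e $ i)"
  unfolding score_def matrix_inv_Sigma_of vector_minus_component diag_mat_mult_vec
    vector_mult_component
  by (intro all_moments_mvnormal_intros)

abbreviation score_sq :: "real ^ 'm \<Rightarrow> real ^ 'm \<Rightarrow> real" where
  "score_sq l e \<equiv> \<Sum>i\<in>UNIV. (score l e $ i)\<^sup>2"

text \<open>Through \<open>fg\<close> the integrand is supplied already in whitened coordinates, so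
  one substitution serves every moment weighted by \<open>score_sq\<close>.\<close>

lemma integral_score_sq_mult:
  fixes l :: "real ^ 'm"
  assumes f: "all_moments (mvnormal (Sigma_of l)) f"
    and g: "all_moments std_gauss g" and fg: "\<And>z. f (\<chi> i. exp (l $ i) * z i) = g z"
  shows "(\<integral>e. score_sq l e * f e \<partial>mvnormal (Sigma_of l)) =
    (\<Sum>i\<in>UNIV. \<integral>z. ((z i)\<^sup>2 - 1)\<^sup>2 * g z \<partial>std_gauss)"
proof -
  have "(\<integral>e. score_sq l e * f e \<partial>mvnormal (Sigma_of l)) =
      (\<integral>z. (\<Sum>i\<in>UNIV. ((z i)\<^sup>2 - 1)\<^sup>2) * g z \<partial>std_gauss)"
    by (subst integral_mvnormal_Sigma_of, intro all_moments_mvnormal_intros all_moments_score f)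
      (simp only: score_scaled fg)
  then show ?thesis
    by (simp add: sum_distrib_right all_moments_integrable all_moments_mult all_moments_hermite_sq g)
qed

lemma all_moments_std_gauss_quad:
  "all_moments std_gauss (\<lambda>z. \<Sum>a\<in>UNIV. \<Sum>b\<in>UNIV. T a b * (z (a :: 'n::finite) * z b))"
  by (intro prob_space.all_moments_intros[OF prob_space_std_gauss] all_moments_coord)

lemma integral_score_sq:
  "(\<integral>e. score_sq l e \<partial>mvnormal (Sigma_of (l :: real ^ 'm))) = 2 * real CARD('m)"
proof -
  have "(\<integral>e. score_sq l e * 1 \<partial>mvnormal (Sigma_of l)) =
    (\<Sum>i\<in>UNIV. \<integral>z. ((z i)\<^sup>2 - 1)\<^sup>2 * 1 \<partial>(std_gauss :: ('m \<Rightarrow> real) measure))"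
    by (rule integral_score_sq_mult)
      (auto intro: prob_space.all_moments_const prob_space_mvnormal prob_space_std_gauss)
  then show ?thesis by (simp add: integral_std_gauss_hermite_sq)
qed

text \<open>Each of the m coordinates contributes twice the full trace of the form and eight times
  its own diagonal entry; the diagonal entries add up to one more trace, hence 2m + 8.\<close>

lemma integral_score_sq_inner_sq:
  fixes l :: "real ^ 'm"
  shows "(\<integral>e. score_sq l e * (w \<bullet> e)\<^sup>2 \<partial>mvnormal (Sigma_of l)) =
    (2 * real CARD('m) + 8) * (w \<bullet> (Sigma_of l *v w))"
proof -
  have "(\<integral>e. score_sq l e * (w \<bullet> e)\<^sup>2 \<partial>mvnormal (Sigma_of l)) =
    (\<Sum>i\<in>UNIV. 2 * (w \<bullet> (Sigma_of l *v w)) + 8 * (w $ i * exp (l $ i) * (w $ i * exp (l $ i))))"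
    by (subst integral_score_sq_mult[OF _ all_moments_std_gauss_quad inner_scaled_sq],
        intro all_moments_mvnormal_intros)
      (simp only: integral_std_gauss_hermite_sq_quad Sigma_of_quad)
  also have "\<dots> = 2 * real CARD('m) * (w \<bullet> (Sigma_of l *v w)) + 8 * (w \<bullet> (Sigma_of l *v w))"
    unfolding sum.distrib sum_distrib_left[symmetric] Sigma_of_quad[symmetric] by simp
  finally show ?thesis by (simp only: distrib_right)
qed

lemma integral_score_sq_quad:
  fixes l :: "real ^ 'm"
  shows "(\<integral>e. score_sq l e * (e \<bullet> (M *v e)) \<partial>mvnormal (Sigma_of l)) =
    (2 * real CARD('m) + 8) * trace (sandwich l M)"
proof -
  have "(\<integral>e. score_sq l e * (e \<bullet> (M *v e)) \<partial>mvnormal (Sigma_of l)) =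
    (\<Sum>i\<in>UNIV. 2 * trace (sandwich l M) + 8 * sandwich l M $ i $ i)"
    by (subst integral_score_sq_mult[OF all_moments_quad all_moments_std_gauss_quad quad_scaled])
      (simp only: integral_std_gauss_hermite_sq_quad trace_def)
  also have "\<dots> = 2 * real CARD('m) * trace (sandwich l M) + 8 * trace (sandwich l M)"
    unfolding sum.distrib sum_distrib_left[symmetric] trace_def[symmetric] by simp
  finally show ?thesis by (simp only: distrib_right)
qed

text \<open>Summed over i, the terms 16 tr S S_ii add 16 to the coefficient of the squared trace,
  and the squared row norms add 32 to that of tr (S S), which is the squared Frobenius norm because
  S is symmetric.\<close>

lemma integral_score_sq_quad_sq:
  fixes l :: "real ^ 'm" and M :: "real ^ 'm ^ 'm"
  assumes M: "transpose M = M"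
  defines "S \<equiv> sandwich l M" and "m \<equiv> real CARD('m)"
  shows "(\<integral>e. score_sq l e * (e \<bullet> (M *v e))\<^sup>2 \<partial>mvnormal (Sigma_of l)) =
    (2 * m + 16) * (trace S)\<^sup>2 + (4 * m + 32) * trace (S ** S) + 24 * (\<Sum>i\<in>UNIV. (S $ i $ i)\<^sup>2)"
proof -
  have sym: "S $ a $ b = S $ b $ a" for a b
  proof -
    have "M $ a $ b = transpose M $ b $ a" by (simp add: transpose_def)
    then show ?thesis by (simp add: S_def sandwich_nth M mult_ac)
  qed
  have SS: "trace (S ** S) = (\<Sum>a\<in>UNIV. \<Sum>b\<in>UNIV. (S $ a $ b)\<^sup>2)"
    unfolding trace_def matrix_matrix_mult_def vec_lambda_beta power2_eq_square
    by (intro sum.cong refl arg_cong2[where f = "(*)"] sym)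
  have "(e \<bullet> (M *v e))\<^sup>2 = (\<Sum>a\<in>UNIV. \<Sum>b\<in>UNIV. S $ a $ b * (z a * z b))\<^sup>2"
    if "e = (\<chi> i. exp (l $ i) * z i)" for e z
    unfolding that quad_scaled S_def ..
  then have "(\<integral>e. score_sq l e * (e \<bullet> (M *v e))\<^sup>2 \<partial>mvnormal (Sigma_of l)) =
    (\<Sum>i\<in>UNIV. \<integral>z. ((z i)\<^sup>2 - 1)\<^sup>2 *
      (\<Sum>a\<in>UNIV. \<Sum>b\<in>UNIV. S $ a $ b * (z a * z b))\<^sup>2 \<partial>std_gauss)"
    by (intro integral_score_sq_mult all_moments_mvnormal_intros all_moments_std_gauss_quad
        prob_space.all_moments_power[OF prob_space_std_gauss]) simp
  also have "\<dots> = (\<Sum>i\<in>UNIV. 2 * (trace S)\<^sup>2 + 4 * trace (S ** S) + 16 * trace S * S $ i $ i +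
      32 * (\<Sum>a\<in>UNIV. (S $ i $ a)\<^sup>2) + 24 * (S $ i $ i)\<^sup>2)"
    unfolding integral_std_gauss_hermite_sq_quad_sq[OF sym] SS
    by (simp only: trace_def mult_ac)
  also have "\<dots> = 2 * m * (trace S)\<^sup>2 + 4 * m * trace (S ** S) + 16 * trace S * trace S +
      32 * trace (S ** S) + 24 * (\<Sum>i\<in>UNIV. (S $ i $ i)\<^sup>2)"
    unfolding sum.distrib sum_distrib_left[symmetric] SS[symmetric] trace_def[symmetric]
    by (simp add: m_def)
  finally show ?thesis by (simp add: power2_eq_square algebra_simps)
qed

lemma integral_score:
  "(\<integral>e. score l e $ i \<partial>mvnormal (Sigma_of (l :: real ^ 'm))) = 0"
  by (subst integral_mvnormal_Sigma_of[OF all_moments_score])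
    (simp only: score_scaled integral_std_gauss_hermite)

lemma integral_score_quad:
  fixes l :: "real ^ 'm"
  shows "(\<integral>e. score l e $ i * (e \<bullet> (M *v e)) \<partial>mvnormal (Sigma_of l)) = 2 * sandwich l M $ i $ i"
  by (subst integral_mvnormal_Sigma_of, intro all_moments_mvnormal_intros all_moments_score)
    (simp only: score_scaled quad_scaled integral_std_gauss_hermite_quad)

section \<open>Reward, objective and estimators\<close>

lemma inner_vector_matrix_mult: "x \<bullet> (y v* A) = (A *v x) \<bullet> (y :: real ^ 'n)"
  by (metis dot_lmul_matrix inner_commute)

lemma reward_eq:
  fixes A :: "real ^ 'n ^ 'n" and B :: "real ^ 'm ^ 'n" and K :: "real ^ 'n ^ 'm"
  assumes "psd Qs" "psd Qa"
  defines "F \<equiv> A + B ** K"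
  shows "reward A B Qs Qa K s e =
    - (s \<bullet> ((transpose F ** Qs ** F + transpose K ** Qa ** K) *v s)
       + 2 * ((transpose (transpose F ** Qs ** B + transpose K ** Qa) *v s) \<bullet> e)
       + e \<bullet> ((transpose B ** Qs ** B + Qa) *v e))"
proof -
  have Qs: "x \<bullet> (Qs *v y) = y \<bullet> (Qs *v x)" for x y
    using assms(1) symmetric_matrix_inner[of Qs] by (metis psd_def inner_commute)
  have Qa: "x \<bullet> (Qa *v y) = y \<bullet> (Qa *v x)" for x y
    using assms(2) symmetric_matrix_inner[of Qa] by (metis psd_def inner_commute)
  \<comment> \<open>The next state is \<open>u + v\<close> and the action is \<open>k + e\<close>,
    each split into a state part and a noise part. Symmetry of the cost matrices merges the two
    mixed terms of each quadratic form, hence the factor 2.\<close>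
  define u v where "u = F *v s" and "v = B *v e"
  define k where "k = K *v s"
  have s': "A *v s + B *v (k + e) = u + v"
    by (simp add: F_def u_def v_def k_def matrix_vector_mult_add_rdistrib matrix_vector_right_distrib
        matrix_vector_mul_assoc)
  have a: "s \<bullet> ((transpose F ** Qs ** F + transpose K ** Qa ** K) *v s) = u \<bullet> (Qs *v u) + k \<bullet> (Qa *v k)"
    by (simp add: u_def k_def matrix_vector_mult_add_rdistrib inner_add_right inner_vector_matrix_mult
        flip: matrix_vector_mul_assoc)
  have b: "(transpose (transpose F ** Qs ** B + transpose K ** Qa) *v s) \<bullet> e = u \<bullet> (Qs *v v) + k \<bullet> (Qa *v e)"
    by (subst inner_commute)
      (simp add: inner_commute[of _ s] u_def v_def k_def matrix_vector_mult_add_rdistrib inner_add_right inner_vector_matrix_mult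
        flip: matrix_vector_mul_assoc)
  have c: "e \<bullet> ((transpose B ** Qs ** B + Qa) *v e) = v \<bullet> (Qs *v v) + e \<bullet> (Qa *v e)"
    by (simp add: v_def matrix_vector_mult_add_rdistrib inner_add_right inner_vector_matrix_mult
        flip: matrix_vector_mul_assoc)
  show ?thesis
    unfolding reward_def Let_def a b c k_def[symmetric] s'
    by (simp add: matrix_vector_right_distrib inner_add_left inner_add_right Qs[of v u] Qa[of e k])
qed

section \<open>The joint law and second moments common to both estimators\<close>

lemma prob_space_joint: "prob_space (joint \<Omega> \<Omega>')"
proof -
  interpret M: prob_space "mvnormal \<Omega>" by (rule prob_space_mvnormal)
  interpret N: prob_space "mvnormal \<Omega>'" by (rule prob_space_mvnormal)
  interpret pair_prob_space "mvnormal \<Omega>" "mvnormal \<Omega>'" ..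
  show ?thesis unfolding joint_def by unfold_locales
qed

lemma integral_joint:
  fixes f :: "real ^ 'n \<Rightarrow> real ^ 'm \<Rightarrow> real"
  assumes "all_moments (joint \<Omega> \<Omega>') (\<lambda>x. f (fst x) (snd x))"
  shows "(\<integral>x. f (fst x) (snd x) \<partial>joint \<Omega> \<Omega>') = (\<integral>s. (\<integral>e. f s e \<partial>mvnormal \<Omega>') \<partial>mvnormal \<Omega>)"
proof -
  interpret M: prob_space "mvnormal \<Omega>" by (rule prob_space_mvnormal)
  interpret N: prob_space "mvnormal \<Omega>'" by (rule prob_space_mvnormal)
  interpret pair_prob_space "mvnormal \<Omega>" "mvnormal \<Omega>'" ..
  show ?thesis
    using integral_fst'[of "\<lambda>x. f (fst x) (snd x)"] all_moments_integrable[OF assms]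
    by (simp add: joint_def)
qed

lemma
  shows all_moments_joint_fst: "all_moments (mvnormal \<Omega>) f \<Longrightarrow> all_moments (joint \<Omega> \<Omega>') (\<lambda>x. f (fst x))"
    and all_moments_joint_snd: "all_moments (mvnormal \<Omega>') g \<Longrightarrow> all_moments (joint \<Omega> \<Omega>') (\<lambda>x. g (snd x))"
  unfolding joint_def
  by (simp_all add: all_moments_fst all_moments_snd prob_space_mvnormal)

lemma all_moments_reward:
  "all_moments (joint \<Omega> \<Omega>') (\<lambda>x. fst x \<bullet> (M *v fst x) + 2 * ((W *v fst x) \<bullet> snd x) + snd x \<bullet> (N *v snd x))"
  by (intro prob_space.all_moments_intros[OF prob_space_joint]
      prob_space.all_moments_inner[OF prob_space_joint] prob_space.all_moments_mult_vec[OF prob_space_joint]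
      all_moments_joint_fst all_moments_joint_snd all_moments_vec_nth)

lemma integral_joint_reward:
  assumes \<Omega>: "psd \<Omega>" and \<Omega>': "psd \<Omega>'"
  shows "(\<integral>x. fst x \<bullet> (M *v fst x) + 2 * ((W *v fst x) \<bullet> snd x) + snd x \<bullet> (N *v snd x) \<partial>joint \<Omega> \<Omega>') =
    M \<bullet> \<Omega> + N \<bullet> \<Omega>'"
proof -
  have "(\<integral>e. a + 2 * (w \<bullet> e) + e \<bullet> (N *v e) \<partial>mvnormal \<Omega>') = a + N \<bullet> \<Omega>'" for a w
    using integral_even_mult_reward[of \<Omega>' "\<lambda>_. 1" a w N]
      prob_space.prob_space[OF prob_space_mvnormal, of \<Omega>'] integral_quad[OF \<Omega>', of N]
    by (simp add: prob_space.all_moments_const[OF prob_space_mvnormal])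
  then have "(\<integral>x. fst x \<bullet> (M *v fst x) + 2 * ((W *v fst x) \<bullet> snd x) + snd x \<bullet> (N *v snd x) \<partial>joint \<Omega> \<Omega>') =
      (\<integral>s. s \<bullet> (M *v s) + N \<bullet> \<Omega>' \<partial>mvnormal \<Omega>)"
    by (subst integral_joint[OF all_moments_reward]) simp
  also have "\<dots> = M \<bullet> \<Omega> + N \<bullet> \<Omega>'"
    using prob_space.prob_space[OF prob_space_mvnormal, of \<Omega>] integral_quad[OF \<Omega>, of M]
    by (simp add: all_moments_integrable all_moments_quad
        prob_space.all_moments_const[OF prob_space_mvnormal])
  finally show ?thesis .
qed

text \<open>Both squared norms have the shape p(s) q(e) r^2 with q even. They differ in how q weighs
  the square of a linear form, which \<open>lin\<close> records by two constants: \<open>c\<close>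
  multiplies the term with the noise covariance, \<open>d\<close> the one without it. The gain
  estimator has d = 2, the log-deviation estimator d = 0.\<close>

lemma integral_joint_reward_sq:
  fixes \<Omega> Mss :: "real ^ 'n ^ 'n" and \<Omega>' Mee :: "real ^ 'm ^ 'm" and Mse :: "real ^ 'm ^ 'n"
  assumes p: "all_moments (mvnormal \<Omega>) p"
    and q: "all_moments (mvnormal \<Omega>') q" "\<And>e. q (- e) = q e"
    and lin: "\<And>w. (\<integral>e. q e * (w \<bullet> e)\<^sup>2 \<partial>mvnormal \<Omega>') = c * (w \<bullet> (\<Omega>' *v w)) + d * (w \<bullet> w)"
  defines "r \<equiv> \<lambda>s e. s \<bullet> (Mss *v s) + 2 * ((transpose Mse *v s) \<bullet> e) + e \<bullet> (Mee *v e)"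
  shows "all_moments (joint \<Omega> \<Omega>') (\<lambda>x. p (fst x) * q (snd x) * (r (fst x) (snd x))\<^sup>2)" (is ?A)
    and "(\<integral>x. p (fst x) * q (snd x) * (r (fst x) (snd x))\<^sup>2 \<partial>joint \<Omega> \<Omega>') =
      (\<integral>e. q e \<partial>mvnormal \<Omega>') * (\<integral>s. p s * (s \<bullet> (Mss *v s))\<^sup>2 \<partial>mvnormal \<Omega>)
      + (\<integral>s. p s \<partial>mvnormal \<Omega>) * (\<integral>e. q e * (e \<bullet> (Mee *v e))\<^sup>2 \<partial>mvnormal \<Omega>')
      + 2 * (\<integral>s. p s * (s \<bullet> (Mss *v s)) \<partial>mvnormal \<Omega>) * (\<integral>e. q e * (e \<bullet> (Mee *v e)) \<partial>mvnormal \<Omega>')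
      + 4 * (c * (\<integral>s. p s * (s \<bullet> ((Mse ** \<Omega>' ** transpose Mse) *v s)) \<partial>mvnormal \<Omega>)
           + d * (\<integral>s. p s * (s \<bullet> ((Mse ** transpose Mse) *v s)) \<partial>mvnormal \<Omega>))" (is ?B)
proof -
  show A: ?A
    unfolding r_def
    by (intro all_moments_mult prob_space.all_moments_power[OF prob_space_joint] all_moments_reward
        all_moments_joint_fst[OF p] all_moments_joint_snd[OF q(1)])
  let ?q = "\<integral>e. q e \<partial>mvnormal \<Omega>'"
  let ?qc = "\<integral>e. q e * (e \<bullet> (Mee *v e)) \<partial>mvnormal \<Omega>'"
  let ?qcc = "\<integral>e. q e * (e \<bullet> (Mee *v e))\<^sup>2 \<partial>mvnormal \<Omega>'"
  let ?V = "Mse ** \<Omega>' ** transpose Mse" and ?U = "Mse ** transpose Mse"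
  have w: "(transpose Mse *v s) \<bullet> (transpose Mse *v s) = s \<bullet> (?U *v s)"
    "(transpose Mse *v s) \<bullet> (\<Omega>' *v (transpose Mse *v s)) = s \<bullet> (?V *v s)" for s
    by (simp_all add: inner_commute[of s] dot_lmul_matrix flip: matrix_vector_mul_assoc)
  have inner: "(\<integral>e. p s * q e * (r s e)\<^sup>2 \<partial>mvnormal \<Omega>') =
      ?q * (p s * (s \<bullet> (Mss *v s))\<^sup>2) + ?qcc * p s + (2 * ?qc) * (p s * (s \<bullet> (Mss *v s)))
      + (4 * c) * (p s * (s \<bullet> (?V *v s))) + (4 * d) * (p s * (s \<bullet> (?U *v s)))" for s
    unfolding r_def mult.assoc Bochner_Integration.integral_mult_right_zero
      integral_even_mult_reward_sq[OF q] lin w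
    by (simp add: algebra_simps)
  have "integrable (mvnormal \<Omega>) p"
    "integrable (mvnormal \<Omega>) (\<lambda>s. p s * (s \<bullet> (Mss *v s))\<^sup>2)"
    "integrable (mvnormal \<Omega>) (\<lambda>s. p s * (s \<bullet> (M *v s)))" for M
    by (intro all_moments_integrable p all_moments_mvnormal_intros)+
  then show ?B
    unfolding integral_joint[OF A] inner by simp
qed

section \<open>Entrywise integration, Frobenius calculus and the gradients of the objective\<close>

lemma bounded_linear_axis: "bounded_linear (axis i :: 'a::real_normed_vector \<Rightarrow> 'a ^ 'n)"
proof (rule bounded_linear_intro[where K = 1])
  show "norm (axis i x :: 'a ^ 'n) \<le> norm x * 1" for x
  proof -
    have "(\<Sum>j\<in>UNIV. (norm ((axis i x :: 'a ^ 'n) $ j))\<^sup>2) = (\<Sum>j\<in>UNIV. if i = j then (norm x)\<^sup>2 else 0)"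
      by (intro sum.cong) (auto simp: axis_def)
    then show ?thesis by (simp add: norm_vec_def L2_set_def)
  qed
qed (auto simp: axis_def vec_eq_iff)

text \<open>The function is a finite sum of bounded linear images of its components. The component
  type is left general so that the result applies to the rows of a matrix and again to the entries
  of a row.\<close>

lemma
  fixes f :: "'a \<Rightarrow> 'b::euclidean_space ^ 'n"
  assumes f: "\<And>i. integrable M (\<lambda>x. f x $ i)"
  shows integrable_vecI: "integrable M f"
    and integral_vec_nth: "(\<integral>x. f x \<partial>M) $ i = (\<integral>x. f x $ i \<partial>M)"
proof -
  have "integrable M (\<lambda>x. \<Sum>i\<in>UNIV. axis i (f x $ i))"
    by (intro Bochner_Integration.integrable_sum integrable_bounded_linear[OF bounded_linear_axis] f)
  also have "(\<lambda>x. \<Sum>i\<in>UNIV. axis i (f x $ i)) = f"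
    by (auto simp: vec_eq_iff axis_def fun_eq_iff if_distrib cong: if_cong)
  finally show int: "integrable M f" .
  show "(\<integral>x. f x \<partial>M) $ i = (\<integral>x. f x $ i \<partial>M)"
    by (rule integral_bounded_linear[OF bounded_linear_vec_nth int, symmetric])
qed

lemma inner_matrix_mult_left:
  fixes X :: "real ^ 'n ^ 'm" and Y :: "real ^ 'k ^ 'n"
  shows "(X ** Y) \<bullet> Z = Y \<bullet> (transpose X ** Z)"
proof -
  have "(X ** Y) \<bullet> Z = (\<Sum>i\<in>UNIV. \<Sum>k\<in>UNIV. \<Sum>j\<in>UNIV. X $ i $ j * Y $ j $ k * Z $ i $ k)"
    by (simp add: inner_vec_def matrix_matrix_mult_def sum_distrib_right)
  also have "\<dots> = (\<Sum>i\<in>UNIV. \<Sum>j\<in>UNIV. \<Sum>k\<in>UNIV. X $ i $ j * Y $ j $ k * Z $ i $ k)"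
    by (intro sum.cong refl sum.swap)
  also have "\<dots> = (\<Sum>j\<in>UNIV. \<Sum>i\<in>UNIV. \<Sum>k\<in>UNIV. X $ i $ j * Y $ j $ k * Z $ i $ k)"
    by (rule sum.swap)
  also have "\<dots> = (\<Sum>j\<in>UNIV. \<Sum>k\<in>UNIV. \<Sum>i\<in>UNIV. X $ i $ j * Y $ j $ k * Z $ i $ k)"
    by (intro sum.cong refl sum.swap)
  finally show ?thesis
    by (simp add: inner_vec_def matrix_matrix_mult_def transpose_def sum_distrib_left mult_ac)
qed

lemma inner_transpose: "transpose X \<bullet> transpose Y = X \<bullet> (Y :: real ^ 'n ^ 'm)"
  unfolding inner_vec_def transpose_def by (simp add: sum.swap[of _ "UNIV :: 'n set"])

lemma inner_matrix_mult_right: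
  fixes X :: "real ^ 'n ^ 'm" and Y :: "real ^ 'k ^ 'n"
  shows "(X ** Y) \<bullet> Z = X \<bullet> (Z ** transpose Y)"
proof -
  have "(X ** Y) \<bullet> Z = (transpose Y ** transpose X) \<bullet> transpose Z"
    by (metis inner_transpose matrix_transpose_mul)
  also have "\<dots> = transpose X \<bullet> (Y ** transpose Z)"
    by (simp add: inner_matrix_mult_left)
  also have "\<dots> = X \<bullet> (Z ** transpose Y)"
    by (metis inner_transpose matrix_transpose_mul transpose_transpose)
  finally show ?thesis .
qed

lemma bounded_linear_matrix_mult:
  "bounded_linear (\<lambda>X :: real ^ 'k ^ 'n. (A :: real ^ 'n ^ 'm) ** X)"
  "bounded_linear (\<lambda>X :: real ^ 'n ^ 'm. X ** (C :: real ^ 'k ^ 'n))"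
  unfolding linear_conv_bounded_linear[symmetric]
  by (auto intro!: linearI simp: matrix_add_ldistrib matrix_scalar_ac scalar_matrix_assoc
      matrix_matrix_mult_def vec_eq_iff sum.distrib sum_distrib_left algebra_simps)

text \<open>The Frobenius product in the statement is the trace of \<open>(A + B K)\<^sup>T Q (A + B K) \<Omega>\<close>.\<close>

lemma has_derivative_quadratic_matrix:
  fixes A :: "real ^ 'n ^ 'k" and B :: "real ^ 'm ^ 'k" and K :: "real ^ 'n ^ 'm"
  assumes Q: "transpose Q = Q" and \<Omega>: "transpose \<Omega> = \<Omega>"
  shows "((\<lambda>K. (transpose (A + B ** K) ** Q ** (A + B ** K)) \<bullet> \<Omega>) has_derivative
    (\<lambda>H. H \<bullet> (2 *\<^sub>R (transpose B ** Q ** (A + B ** K) ** \<Omega>)))) (at K)"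
proof -
  let ?F = "\<lambda>K. A + B ** K"
  note bl = bounded_linear_matrix_mult[THEN bounded_linear.has_derivative]
  have F: "(?F has_derivative (\<lambda>H. B ** H)) (at K)"
    by (auto intro!: derivative_eq_intros bl)
  \<comment> \<open>As a Frobenius product of two factors affine in \<open>K\<close>, the expression
    falls under the product rule. Symmetry of \<open>\<Omega>\<close> handles one half and symmetry
    of \<open>Q\<close> the other; both give the same value, hence the factor 2.\<close>
  have "((\<lambda>K. (Q ** ?F K) \<bullet> (?F K ** \<Omega>)) has_derivative
      (\<lambda>H. (Q ** ?F K) \<bullet> ((B ** H) ** \<Omega>) + (Q ** (B ** H)) \<bullet> (?F K ** \<Omega>))) (at K)"
    by (intro has_derivative_inner bl F)
  moreover have "(Q ** X) \<bullet> (X ** \<Omega>) = (transpose X ** Q ** X) \<bullet> \<Omega>" for X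
    by (simp add: inner_matrix_mult_left flip: matrix_mul_assoc)
  moreover have "(Q ** X) \<bullet> ((B ** H) ** \<Omega>) + (Q ** (B ** H)) \<bullet> (X ** \<Omega>) =
      H \<bullet> (2 *\<^sub>R (transpose B ** Q ** X ** \<Omega>))" for X H
  proof -
    have "(Q ** (B ** H)) \<bullet> (X ** \<Omega>) = H \<bullet> (transpose B ** Q ** X ** \<Omega>)"
      by (simp add: inner_matrix_mult_left Q flip: matrix_mul_assoc)
    moreover have "(Q ** X) \<bullet> ((B ** H) ** \<Omega>) = H \<bullet> (transpose B ** Q ** X ** \<Omega>)"
      by (subst inner_commute, subst inner_matrix_mult_right, subst inner_matrix_mult_left)
        (simp add: \<Omega> matrix_mul_assoc)
    ultimately show ?thesis by simp
  qed
  ultimately show ?thesis by simp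
qed

lemma J_eq:
  fixes A :: "real ^ 'n ^ 'n" and B :: "real ^ 'm ^ 'n" and K :: "real ^ 'n ^ 'm"
  assumes "psd Qs" "psd Qa" "psd \<Omega>" "psd \<Omega>'"
  defines "F \<equiv> A + B ** K"
  shows "J A B Qs Qa \<Omega> K \<Omega>' =
    - ((transpose F ** Qs ** F + transpose K ** Qa ** K) \<bullet> \<Omega> + (transpose B ** Qs ** B + Qa) \<bullet> \<Omega>')"
  unfolding J_def case_prod_unfold reward_eq[OF assms(1,2)] Bochner_Integration.integral_minus
    integral_joint_reward[OF assms(3,4)] F_def ..

lemma matrix_mult_add_rdistrib: "(X + Y) ** Z = X ** Z + Y ** (Z :: real ^ 'k ^ 'n)"
  by (simp add: matrix_matrix_mult_def vec_eq_iff sum.distrib algebra_simps)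

lemma GDERIV_J_gain:
  fixes A :: "real ^ 'n ^ 'n" and B :: "real ^ 'm ^ 'n" and K :: "real ^ 'n ^ 'm"
  assumes psd: "psd Qs" "psd Qa" "psd \<Omega>" "psd \<Omega>'"
  defines "F \<equiv> A + B ** K"
  shows "GDERIV (\<lambda>K. J A B Qs Qa \<Omega> K \<Omega>') K :>
    (- 2) *\<^sub>R (transpose (transpose F ** Qs ** B + transpose K ** Qa) ** \<Omega>)"
proof -
  have sym: "transpose Qs = Qs" "transpose Qa = Qa" "transpose \<Omega> = \<Omega>"
    using psd by (simp_all add: psd_def)
  \<comment> \<open>Writing \<open>K\<close> as \<open>0 + mat 1 ** K\<close> makes the action cost
    an instance of the same quadratic derivative, with zero drift and identity input.\<close>
  have "((\<lambda>K. - ((transpose (A + B ** K) ** Qs ** (A + B ** K)) \<bullet> \<Omega>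
        + (transpose (0 + mat 1 ** K) ** Qa ** (0 + mat 1 ** K)) \<bullet> \<Omega>
        + (transpose B ** Qs ** B + Qa) \<bullet> \<Omega>')) has_derivative
      (\<lambda>H. - (H \<bullet> (2 *\<^sub>R (transpose B ** Qs ** (A + B ** K) ** \<Omega>))
        + H \<bullet> (2 *\<^sub>R (transpose (mat 1) ** Qa ** (0 + mat 1 ** K) ** \<Omega>)) + 0))) (at K)"
    by (intro has_derivative_minus has_derivative_add has_derivative_const
        has_derivative_quadratic_matrix sym)
  moreover have "- (H \<bullet> (2 *\<^sub>R (transpose B ** Qs ** (A + B ** K) ** \<Omega>))
        + H \<bullet> (2 *\<^sub>R (transpose (mat 1) ** Qa ** (0 + mat 1 ** K) ** \<Omega>)) + 0) =
      H \<bullet> ((- 2) *\<^sub>R (transpose (transpose F ** Qs ** B + transpose K ** Qa) ** \<Omega>))" for H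
  proof -
    have "transpose (X + Y) = transpose X + transpose Y" for X Y :: "real ^ 'm ^ 'n"
      by (simp add: transpose_def vec_eq_iff)
    then have "transpose (transpose F ** Qs ** B + transpose K ** Qa) ** \<Omega> =
        transpose B ** Qs ** (A + B ** K) ** \<Omega> + Qa ** K ** \<Omega>"
      by (simp add: matrix_transpose_mul sym F_def matrix_mult_add_rdistrib matrix_mul_assoc)
    then show ?thesis by (simp add: inner_add_right transpose_mat)
  qed
  ultimately show ?thesis
    by (simp add: gderiv_def J_eq[OF psd] inner_add_left)
qed

text \<open>Against a diagonal covariance only the diagonal of the noise cost matrix counts, and
  each exp (2 l_i) reproduces itself with a factor 2; the state part of the objective is constant in
  \<open>l\<close>.\<close>

lemma GDERIV_J_log_std:
  fixes B :: "real ^ 'm ^ 'n" and l :: "real ^ 'm"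
  assumes psd: "psd Qs" "psd Qa" "psd \<Omega>"
  shows "GDERIV (\<lambda>l. J A B Qs Qa \<Omega> K (Sigma_of l)) l :>
    (- 2) *\<^sub>R diag_of (Sigma_of l ** (transpose B ** Qs ** B + Qa))"
proof -
  let ?M = "transpose B ** Qs ** B + Qa"
  let ?c = "(transpose (A + B ** K) ** Qs ** (A + B ** K) + transpose K ** Qa ** K) \<bullet> \<Omega>"
  have M: "M \<bullet> Sigma_of l = (\<Sum>i\<in>UNIV. M $ i $ i * exp (2 * l $ i))" for M and l :: "real ^ 'm"
    by (simp add: inner_vec_def Sigma_of_def if_distrib cong: if_cong)
  have "((\<lambda>l. - (?c + (\<Sum>i\<in>UNIV. ?M $ i $ i * exp (2 * l $ i)))) has_derivative
      (\<lambda>h. - (0 + (\<Sum>i\<in>UNIV. ?M $ i $ i * (exp (2 * l $ i) * (2 * h $ i)))))) (at l)"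
    by (auto intro!: derivative_eq_intros bounded_linear.has_derivative[OF bounded_linear_vec_nth]
        simp: mult_ac)
  moreover have "- (0 + (\<Sum>i\<in>UNIV. ?M $ i $ i * (exp (2 * l $ i) * (2 * h $ i)))) =
      h \<bullet> ((- 2) *\<^sub>R diag_of (Sigma_of l ** ?M))" for h :: "real ^ 'm"
  proof -
    have "(Sigma_of l ** ?M) $ i $ i = exp (2 * l $ i) * ?M $ i $ i" for i
      by (simp add: matrix_matrix_mult_def Sigma_of_def if_distrib if_distribR cong: if_cong)
    then show ?thesis by (simp add: inner_vec_def diag_of_def sum_distrib_left mult_ac sum_negf)
  qed
  ultimately show ?thesis
    by (simp add: gderiv_def J_eq[OF psd psd_Sigma_of] M)
qed

section \<open>Entries and squared norms of the estimators\<close>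

lemma G_K_nth: "G_K (Sigma_of l) s e r $ i $ j = exp (- 2 * l $ i) * s $ j * (e $ i * r)"
  by (simp add: G_K_def matrix_inv_Sigma_of outer_def diag_mat_def matrix_matrix_mult_def
      if_distrib if_distribR cong: if_cong)

lemma norm_G_K_sq:
  "(norm (G_K (Sigma_of l) s e r))\<^sup>2 = s \<bullet> (mat 1 *v s) * (e \<bullet> (precision_sq l *v e)) * r\<^sup>2"
proof -
  have "(norm (G_K (Sigma_of l) s e r))\<^sup>2 =
      (\<Sum>i\<in>UNIV. \<Sum>j\<in>UNIV. (exp (- 2 * l $ i) * s $ j * (e $ i * r))\<^sup>2)"
    unfolding power2_norm_eq_inner unfolding inner_vec_def G_K_nth inner_real_def power2_eq_square ..
  also have "\<dots> = (\<Sum>j\<in>UNIV. s $ j * s $ j) * (\<Sum>i\<in>UNIV. (exp (- 2 * l $ i) * e $ i)\<^sup>2) * r\<^sup>2"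
    by (simp add: sum_distrib_left sum_distrib_right power_mult_distrib power2_eq_square mult_ac)
  also have "\<dots> = s \<bullet> (mat 1 *v s) * (e \<bullet> (precision_sq l *v e)) * r\<^sup>2"
    unfolding precision_sq_quad matrix_vector_mul_lid inner_vec_def[of s] inner_real_def ..
  finally show ?thesis .
qed

lemma G_l_eq: "G_l (Sigma_of l) e r = r *\<^sub>R score l e"
  by (simp add: G_l_def score_def)

text \<open>The leading \<open>1\<close> is the state factor p(s) of the common second-moment
  formula.\<close>

lemma norm_G_l_sq: "(norm (G_l (Sigma_of l) e r))\<^sup>2 = 1 * score_sq l e * r\<^sup>2"
  unfolding G_l_eq power2_norm_eq_inner
  by (simp add: inner_vec_def power2_eq_square sum_distrib_left mult_ac)

lemma IS_1: "IS \<Omega> [M] = (\<integral>x. x \<bullet> (M *v x) \<partial>mvnormal \<Omega>)"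
  by (simp add: IS_def)

lemma IS_2: "IS \<Omega> [M, M'] = (\<integral>x. x \<bullet> (M *v x) * (x \<bullet> (M' *v x)) \<partial>mvnormal \<Omega>)"
  by (simp add: IS_def)

lemma IS_2_same: "IS \<Omega> [M, M] = (\<integral>x. (x \<bullet> (M *v x))\<^sup>2 \<partial>mvnormal \<Omega>)"
  by (simp add: IS_def power2_eq_square)

lemma IS_3: "IS \<Omega> [M, M', M'] = (\<integral>x. x \<bullet> (M *v x) * (x \<bullet> (M' *v x))\<^sup>2 \<partial>mvnormal \<Omega>)"
  by (simp add: IS_def power2_eq_square)

theorem theorem3:
  fixes A :: "real ^ 'n ^ 'n" and B :: "real ^ 'm ^ 'n" and K :: "real ^ 'n ^ 'm"
    and Qs \<Sigma>0 :: "real ^ 'n ^ 'n" and Qa :: "real ^ 'm ^ 'm" and l :: "real ^ 'm"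
  assumes "psd Qs" and "psd Qa" and "psd \<Sigma>0"
  defines "\<Sigma> \<equiv> Sigma_of l"
  defines "m \<equiv> real CARD('m)"
  defines "F \<equiv> A + B ** K"
  defines "Mss \<equiv> transpose F ** Qs ** F + transpose K ** Qa ** K"
  defines "Mse \<equiv> transpose F ** Qs ** B + transpose K ** Qa"
  defines "Mee \<equiv> transpose B ** Qs ** B + Qa"
  defines "P \<equiv> joint \<Sigma>0 \<Sigma>"
  defines "GK \<equiv> (\<lambda>(s, e). G_K \<Sigma> s e (reward A B Qs Qa K s e))"
  defines "Gl \<equiv> (\<lambda>(s, e). G_l \<Sigma> e (reward A B Qs Qa K s e))"
  defines "Sinv2 \<equiv> matrix_inv \<Sigma> ** matrix_inv \<Sigma>"
  defines "U \<equiv> Mse ** transpose Mse"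
  defines "V \<equiv> Mse ** \<Sigma> ** transpose Mse"
  defines "S \<equiv> psd_sqrt \<Sigma> ** Mee ** psd_sqrt \<Sigma>"
  defines "E1K \<equiv> IS \<Sigma> [Sinv2] * IS \<Sigma>0 [mat 1, Mss, Mss]"
  defines "E2K \<equiv> IS \<Sigma>0 [mat 1] * IS \<Sigma> [Sinv2, Mee, Mee]"
  defines "E3K \<equiv> 2 * IS \<Sigma>0 [mat 1, Mss] * IS \<Sigma> [Sinv2, Mee]"
  defines "E4K \<equiv> 4 * (2 * IS \<Sigma>0 [mat 1, U] + IS \<Sigma> [Sinv2] * IS \<Sigma>0 [mat 1, V])"
  defines "E1l \<equiv> 2 * m * IS \<Sigma>0 [Mss, Mss]"
  defines "E2l \<equiv> (2 * m + 16) * (trace S)\<^sup>2 + (4 * m + 32) * trace (S ** S)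
                   + 24 * (\<Sum>i\<in>UNIV. (S $ i $ i)\<^sup>2)"
  defines "E3l \<equiv> 2 * IS \<Sigma>0 [Mss] * (2 * m + 8) * trace S"
  defines "E4l \<equiv> 4 * (2 * m + 8) * IS \<Sigma>0 [V]"
  shows
    "(integrable P (\<lambda>(s, e). reward A B Qs Qa K s e) \<and> integrable P GK \<and> integrable P Gl
      \<and> GDERIV (\<lambda>K'. J A B Qs Qa \<Sigma>0 K' \<Sigma>) K :> (\<integral>x. GK x \<partial>P)
      \<and> (\<integral>x. GK x \<partial>P) = (- 2) *\<^sub>R (transpose Mse ** \<Sigma>0)
      \<and> GDERIV (\<lambda>l'. J A B Qs Qa \<Sigma>0 K (Sigma_of l')) l :> (\<integral>x. Gl x \<partial>P)
      \<and> (\<integral>x. Gl x \<partial>P) = (- 2) *\<^sub>R diag_of (\<Sigma> ** Mee))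
   \<and> (integrable P (\<lambda>x. (norm (GK x))\<^sup>2)
      \<and> (\<integral>x. (norm (GK x))\<^sup>2 \<partial>P) = E1K + E2K + E3K + E4K)
   \<and> (integrable P (\<lambda>x. (norm (Gl x))\<^sup>2)
      \<and> (\<integral>x. (norm (Gl x))\<^sup>2 \<partial>P) = E1l + E2l + E3l + E4l)"
proof -
  note psd = assms(1-3)
  define r where "r s e = s \<bullet> (Mss *v s) + 2 * ((transpose Mse *v s) \<bullet> e) + e \<bullet> (Mee *v e)" for s e
  have reward: "reward A B Qs Qa K s e = - r s e" for s e
    unfolding reward_eq[OF psd(1,2)] r_def Mss_def Mse_def Mee_def F_def ..
  note joint_intros = prob_space.all_moments_intros[OF prob_space_joint]
    all_moments_joint_fst[OF all_moments_vec_nth] all_moments_joint_snd[OF all_moments_vec_nth]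
    all_moments_joint_snd[OF all_moments_score] all_moments_reward
  have psd\<Sigma>: "psd \<Sigma>" by (simp add: \<Sigma>_def psd_Sigma_of)

  have int_reward: "integrable P (\<lambda>(s, e). reward A B Qs Qa K s e)"
    unfolding case_prod_unfold reward r_def P_def
    by (intro all_moments_integrable joint_intros)

  \<comment> \<open>The factor depending on the state stands in front, so that it can be pulled out
    of the inner integral over the noise.\<close>
  have GK_nth: "GK x $ i $ j = - exp (- 2 * l $ i) * fst x $ j * (snd x $ i * r (fst x) (snd x))" for x i j
    by (simp add: GK_def case_prod_unfold reward \<Sigma>_def G_K_nth)
  have am_GK: "all_moments P (\<lambda>x. GK x $ i $ j)" for i j
    unfolding GK_nth r_def P_def by (intro joint_intros)
  have int_GK: "integrable P GK"
    by (intro integrable_vecI all_moments_integrable am_GK)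
  have mean_GK: "(\<integral>x. GK x \<partial>P) = (- 2) *\<^sub>R (transpose Mse ** \<Sigma>0)"
  proof -
    have "(\<integral>x. GK x \<partial>P) $ i $ j = ((- 2) *\<^sub>R (transpose Mse ** \<Sigma>0)) $ i $ j" for i j
    proof -
      have "(\<integral>x. GK x \<partial>P) $ i $ j = (\<integral>x. GK x $ i $ j \<partial>P)"
        by (simp add: integral_vec_nth integrable_vecI all_moments_integrable[OF am_GK])
      also have "\<dots> = (\<integral>s. (\<integral>e. - exp (- 2 * l $ i) * s $ j * (e $ i * r s e) \<partial>mvnormal \<Sigma>) \<partial>mvnormal \<Sigma>0)"
        unfolding GK_nth P_def
        by (rule integral_joint) (use am_GK[of i j] in \<open>simp only: GK_nth P_def\<close>)
      also have "\<dots> = (\<integral>s. - 2 * (s $ j * (transpose Mse $ i \<bullet> s)) \<partial>mvnormal \<Sigma>0)"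
      proof (rule Bochner_Integration.integral_cong[OF refl])
        fix s
        \<comment> \<open>The inverse covariance in the estimator cancels the covariance produced by
          E[e e^T], so the mean gain gradient does not depend on the policy noise.\<close>
        have "exp (- 2 * l $ i) * exp (2 * l $ i) = 1" by (simp add: mult_exp_exp)
        moreover have "(\<Sigma> *v (transpose Mse *v s)) $ i = exp (2 * l $ i) * (transpose Mse $ i \<bullet> s)"
          unfolding \<Sigma>_def Sigma_of_eq diag_mat_mult_vec unfolding matrix_vector_mul_component ..
        ultimately show "(\<integral>e. - exp (- 2 * l $ i) * s $ j * (e $ i * r s e) \<partial>mvnormal \<Sigma>) =
            - 2 * (s $ j * (transpose Mse $ i \<bullet> s))"
          unfolding r_def Bochner_Integration.integral_mult_right_zero integral_nth_mult_reward[OF psd\<Sigma>]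
          by (simp only: mult_ac) (simp add: mult_ac)
      qed
      also have "\<dots> = - 2 * (\<Sigma>0 *v (transpose Mse $ i)) $ j"
        by (simp only: Bochner_Integration.integral_mult_right_zero integral_nth_inner[OF psd(3)])
      also have "(\<Sigma>0 *v (transpose Mse $ i)) $ j = (transpose Mse ** \<Sigma>0) $ i $ j"
      proof -
        have "\<Sigma>0 $ j $ k = \<Sigma>0 $ k $ j" for k
        proof -
          have "\<Sigma>0 $ j $ k = transpose \<Sigma>0 $ k $ j" by (simp add: transpose_def)
          then show ?thesis using psd(3) by (simp add: psd_def)
        qed
        then show ?thesis by (simp add: matrix_vector_mult_def matrix_matrix_mult_def mult.commute)
      qed
      finally show ?thesis by simp
    qed
    then show ?thesis by (simp add: vec_eq_iff)
  qed

  have Gl_nth: "Gl x $ i = - (score l (snd x) $ i * r (fst x) (snd x))" for x i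
    by (simp add: Gl_def case_prod_unfold reward \<Sigma>_def G_l_eq)
  have am_Gl: "all_moments P (\<lambda>x. Gl x $ i)" for i
    unfolding Gl_nth r_def P_def by (intro joint_intros)
  have int_Gl: "integrable P Gl"
    by (intro integrable_vecI all_moments_integrable am_Gl)
  have mean_Gl: "(\<integral>x. Gl x \<partial>P) = (- 2) *\<^sub>R diag_of (\<Sigma> ** Mee)"
  proof -
    have "(\<integral>x. Gl x \<partial>P) $ i = ((- 2) *\<^sub>R diag_of (\<Sigma> ** Mee)) $ i" for i
    proof -
      \<comment> \<open>The part of the reward free of noise acts as a baseline: it is multiplied by
        the mean of the score, which is zero.\<close>
      have inner: "(\<integral>e. - (score l e $ i * r s e) \<partial>mvnormal \<Sigma>) = - 2 * sandwich l Mee $ i $ i" for s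
        unfolding r_def \<Sigma>_def Bochner_Integration.integral_minus
        by (subst integral_even_mult_reward[OF all_moments_score])
          (simp_all add: score_uminus integral_score integral_score_quad)
      have "(\<integral>x. Gl x \<partial>P) $ i = (\<integral>x. Gl x $ i \<partial>P)"
        by (rule integral_vec_nth) (rule all_moments_integrable[OF am_Gl])
      also have "\<dots> = (\<integral>s. (\<integral>e. - (score l e $ i * r s e) \<partial>mvnormal \<Sigma>) \<partial>mvnormal \<Sigma>0)"
        unfolding Gl_nth P_def
        by (rule integral_joint) (use am_Gl[of i] in \<open>simp only: Gl_nth P_def\<close>)
      also have "\<dots> = - 2 * sandwich l Mee $ i $ i"
        unfolding inner using prob_space.prob_space[OF prob_space_mvnormal, of \<Sigma>0] by simp
      \<comment> \<open>The two matrices differ in general, but their diagonals agree because the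
        covariance is diagonal.\<close>
      also have "sandwich l Mee $ i $ i = (\<Sigma> ** Mee) $ i $ i"
      proof -
        have "exp (2 * l $ i) = exp (l $ i) * exp (l $ i)" by (simp add: mult_exp_exp)
        then show ?thesis
          by (simp add: sandwich_nth \<Sigma>_def Sigma_of_def matrix_matrix_mult_def if_distrib if_distribR
              cong: if_cong)
      qed
      finally show ?thesis by (simp add: diag_of_def)
    qed
    then show ?thesis by (simp add: vec_eq_iff)
  qed

  have grad_K: "GDERIV (\<lambda>K'. J A B Qs Qa \<Sigma>0 K' \<Sigma>) K :> (\<integral>x. GK x \<partial>P)"
    unfolding mean_GK Mse_def F_def by (rule GDERIV_J_gain[OF psd psd\<Sigma>])
  have grad_l: "GDERIV (\<lambda>l'. J A B Qs Qa \<Sigma>0 K (Sigma_of l')) l :> (\<integral>x. Gl x \<partial>P)"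
    unfolding mean_Gl Mee_def \<Sigma>_def by (rule GDERIV_J_log_std[OF psd])

  have GK_sq: "(norm (GK x))\<^sup>2 = fst x \<bullet> (mat 1 *v fst x) * (snd x \<bullet> (Sinv2 *v snd x)) * (r (fst x) (snd x))\<^sup>2" for x
    by (simp only: GK_def case_prod_unfold reward \<Sigma>_def norm_G_K_sq Sinv2_def power2_minus)
  have even: "(- e) \<bullet> (Sinv2 *v (- e)) = e \<bullet> (Sinv2 *v e)" for e
    by (simp add: matrix_vector_mult_uminus)
  have lin: "(\<integral>e. e \<bullet> (Sinv2 *v e) * (w \<bullet> e)\<^sup>2 \<partial>mvnormal \<Sigma>) =
      IS \<Sigma> [Sinv2] * (w \<bullet> (\<Sigma> *v w)) + 2 * (w \<bullet> w)" for w
    by (simp only: IS_1 Sinv2_def \<Sigma>_def integral_precision_sq_inner integral_precision_sq)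
  \<comment> \<open>Here p is the squared norm of the state and q the squared norm of the precision
    applied to the noise; \<open>lin\<close> provides the constants c =
    \<open>IS \<Sigma> [Sinv2]\<close> and d = 2 found in \<open>E4K\<close>.\<close>
  note K_sq = integral_joint_reward_sq[OF all_moments_quad all_moments_quad even lin,
      of \<Sigma>0 "mat 1" Mss Mse Mee, folded r_def GK_sq P_def]
  have int_K: "integrable P (\<lambda>x. (norm (GK x))\<^sup>2)"
    by (rule all_moments_integrable[OF K_sq(1)])
  have mean_K: "(\<integral>x. (norm (GK x))\<^sup>2 \<partial>P) = E1K + E2K + E3K + E4K"
    unfolding K_sq(2) E1K_def E2K_def E3K_def E4K_def IS_1 IS_2 IS_3 U_def V_def
    by (simp add: algebra_simps)

  have Gl_sq: "(norm (Gl x))\<^sup>2 = 1 * score_sq l (snd x) * (r (fst x) (snd x))\<^sup>2" for x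
    by (simp only: Gl_def case_prod_unfold reward \<Sigma>_def norm_G_l_sq power2_minus)
  have am_score_sq: "all_moments (mvnormal \<Sigma>) (score_sq l)"
    by (intro all_moments_mvnormal_intros all_moments_score)
  have even_score_sq: "score_sq l (- e) = score_sq l e" for e
    by (simp add: score_uminus)
  \<comment> \<open>The null term \<open>0 * (w \<bullet> w)\<close> fits the pattern with constants
    c and d; with d = 0 no summand with \<open>U\<close> arises in \<open>E4l\<close>.\<close>
  have lin_l: "(\<integral>e. score_sq l e * (w \<bullet> e)\<^sup>2 \<partial>mvnormal \<Sigma>) = (2 * m + 8) * (w \<bullet> (\<Sigma> *v w)) + 0 * (w \<bullet> w)" for w
    by (simp add: \<Sigma>_def m_def integral_score_sq_inner_sq)
  note l_sq = integral_joint_reward_sq[where p = "\<lambda>_. 1" and \<Omega> = \<Sigma>0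
      and Mss = Mss and Mse = Mse and Mee = Mee,
      OF prob_space.all_moments_const[OF prob_space_mvnormal] am_score_sq even_score_sq lin_l,
      folded r_def P_def]
  have int_l: "integrable P (\<lambda>x. (norm (Gl x))\<^sup>2)"
    unfolding Gl_sq by (rule all_moments_integrable[OF l_sq(1)])
  have S: "S = sandwich l Mee" by (simp add: S_def sandwich_def \<Sigma>_def)
  have "transpose Qs = Qs" "transpose Qa = Qa" using psd by (simp_all add: psd_def)
  moreover have "transpose (X + Y) = transpose X + transpose Y" for X Y :: "real ^ 'm ^ 'm"
    by (simp add: transpose_def vec_eq_iff)
  ultimately have sym: "transpose Mee = Mee"
    by (simp add: Mee_def matrix_transpose_mul matrix_mul_assoc)
  have mean_l: "(\<integral>x. (norm (Gl x))\<^sup>2 \<partial>P) = E1l + E2l + E3l + E4l"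
  proof -
    have q: "(\<integral>e. score_sq l e \<partial>mvnormal \<Sigma>) = 2 * m"
      "(\<integral>e. score_sq l e * (e \<bullet> (Mee *v e)) \<partial>mvnormal \<Sigma>) = (2 * m + 8) * trace S"
      "(\<integral>e. score_sq l e * (e \<bullet> (Mee *v e))\<^sup>2 \<partial>mvnormal \<Sigma>) = E2l"
      unfolding \<Sigma>_def m_def S E2l_def
      by (rule integral_score_sq integral_score_sq_quad integral_score_sq_quad_sq[OF sym])+
    have "(\<integral>s. 1 \<partial>mvnormal \<Sigma>0) = (1 :: real)"
      using prob_space.prob_space[OF prob_space_mvnormal, of \<Sigma>0] by simp
    then show ?thesis
      unfolding Gl_sq l_sq(2) q E1l_def E3l_def E4l_def IS_1 IS_2_same V_def
      by (simp add: algebra_simps)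
  qed

  show ?thesis
    using int_reward int_GK int_Gl grad_K mean_GK grad_l mean_Gl int_K mean_K int_l mean_l by blast
qed

end
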